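(* For $T\in{\rm Aut}(X,\mathcal B,\mu)$ the following are equivalent: (i) $T$ is rigid; (ii) $\widetilde T$ is pointwise recurrent on $C_2(\mu)$; (iii) $\widetilde T$ is rigid; (iv) $\widetilde T$ is uniformly rigid.
   Context: $C_2(\mu)$: probability measures on $X\times X$ with both marginals $\mu$, with the compact metrizable topology $\rho_n\to\rho$ iff $\rho_n(A\times B)\to\rho(A\times B)$ for all measurable $A,B$. The topological lens: $\widetilde T(\rho)(A\times B)=\rho(T^{-1}A\times T^{-1}B)$. $T$ is rigid if $U_T^{n_i}\to{\rm Id}$ on $L^2(\mu)$ for some increasing $(n_i)$, where $U_Tf=f\circ T$. A homeomorphism $R$ of a compact metric space is pointwise recurrent if every point returns infinitely often to each of its neighbourhoods; rigid (resp. uniformly rigid) if $R^{n_i}\to{\rm Id}$ pointwise (resp. uniformly) along some increasing sequence $(n_i)$. *)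

theory Defs
  imports "HOL-Probability.Probability"
begin

definition C2 :: "'a measure \<Rightarrow> ('a \<times> 'a) measure set" where
  "C2 M = {\<rho>. sets \<rho> = sets (M \<Otimes>\<^sub>M M) \<and> prob_space \<rho> \<and>
               distr \<rho> M fst = M \<and> distr \<rho> M snd = M}"

definition rect_eval :: "'a measure \<Rightarrow> ('a \<times> 'a) measure \<Rightarrow> ('a set \<times> 'a set \<Rightarrow> real)" where
  "rect_eval M \<rho> = (\<lambda>(A, B). if A \<in> sets M \<and> B \<in> sets M then measure \<rho> (A \<times> B) else 0)"

text \<open>The topology on C_2(mu): the coarsest one making all maps rho |-> rho(A x B)
  (A, B measurable) continuous, i.e. rho_n -> rho iff rho_n(A x B) -> rho(A x B) for all A, B.\<close>
definition C2_topology :: "'a measure \<Rightarrow> ('a \<times> 'a) measure topology" where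
  "C2_topology M = pullback_topology (C2 M) (rect_eval M) euclidean"

definition lens :: "'a measure \<Rightarrow> ('a \<Rightarrow> 'a) \<Rightarrow> ('a \<times> 'a) measure \<Rightarrow> ('a \<times> 'a) measure" where
  "lens M T \<rho> = distr \<rho> (M \<Otimes>\<^sub>M M) (map_prod T T)"

definition aut :: "'a measure \<Rightarrow> ('a \<Rightarrow> 'a) \<Rightarrow> bool" where
  "aut M T \<longleftrightarrow> bij T \<and> T \<in> M \<rightarrow>\<^sub>M M \<and> distr M M T = M \<and> inv T \<in> M \<rightarrow>\<^sub>M M \<and> distr M M (inv T) = M"

text \<open>Rigidity of T: U_T^{n_i} -> Id (strongly) on L^2(mu), U_T f = f o T.\<close>
definition rigid_mp :: "'a measure \<Rightarrow> ('a \<Rightarrow> 'a) \<Rightarrow> bool" where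
  "rigid_mp M T \<longleftrightarrow> (\<exists>n::nat \<Rightarrow> nat. strict_mono n \<and>
     (\<forall>f::'a \<Rightarrow> complex. f \<in> borel_measurable M \<and> integrable M (\<lambda>x. (cmod (f x))\<^sup>2) \<longrightarrow>
        (\<lambda>i. \<integral>x. (cmod (f ((T ^^ n i) x) - f x))\<^sup>2 \<partial>M) \<longlonglongrightarrow> 0))"

definition pointwise_recurrent :: "'b topology \<Rightarrow> ('b \<Rightarrow> 'b) \<Rightarrow> bool" where
  "pointwise_recurrent X R \<longleftrightarrow>
     (\<forall>x\<in>topspace X. \<forall>U. openin X U \<and> x \<in> U \<longrightarrow> infinite {n. (R ^^ n) x \<in> U})"

definition top_rigid :: "'b topology \<Rightarrow> ('b \<Rightarrow> 'b) \<Rightarrow> bool" where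
  "top_rigid X R \<longleftrightarrow> (\<exists>n::nat \<Rightarrow> nat. strict_mono n \<and>
     (\<forall>x\<in>topspace X. limitin X (\<lambda>i. (R ^^ n i) x) x sequentially))"

definition unif_rigid :: "'b set \<Rightarrow> ('b \<Rightarrow> 'b \<Rightarrow> real) \<Rightarrow> ('b \<Rightarrow> 'b) \<Rightarrow> bool" where
  "unif_rigid S d R \<longleftrightarrow> (\<exists>n::nat \<Rightarrow> nat. strict_mono n \<and>
     (\<forall>\<epsilon>>0. eventually (\<lambda>i. \<forall>x\<in>S. d ((R ^^ n i) x) x < \<epsilon>) sequentially))"

end

theory Submission
  imports Defs
begin

text \<open>
  The lens moves the measure of a rectangle \<open>A \<times> B\<close> by at most
  \<open>\<mu>(T\<^sup>-\<^sup>n A \<triangle> A) + \<mu>(T\<^sup>-\<^sup>n B \<triangle> B)\<close>, uniformly over all couplings, so rigidity of \<open>T\<close> gives rigidity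
  of the lens, and compactness of \<open>C\<^sub>2(\<mu>)\<close> upgrades this to uniform rigidity for every compatible
  metric.

  Conversely, recurrence of a single coupling suffices. Let \<open>f\<close> code a countable generator of the
  \<open>\<sigma>\<close>-algebra by ternary digits 0 and 2, put \<open>\<phi> = f - \<integral>f\<close>, and let \<open>\<rho>\<close> have density
  \<open>1 + \<phi>(x) \<phi>(y)\<close>. Recurrence of \<open>\<rho>\<close> yields arbitrarily large \<open>n\<close> with
  \<open>\<langle>\<phi> \<circ> T\<^sup>n, \<phi>\<rangle>\<^sup>2\<close> close to \<open>\<parallel>\<phi>\<parallel>\<^sup>4\<close>, so \<open>\<phi> \<circ> T\<^sup>n\<close> is close to \<open>\<phi>\<close> or to \<open>-\<phi>\<close>; in the second case
  \<open>\<phi> \<circ> T\<^sup>2\<^sup>n\<close> is close to \<open>\<phi>\<close>. As \<open>f\<close> determines every generator in a Lipschitz way, the sets of the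
  generator, hence all measurable sets, return along these times.
\<close>

section \<open>Pullback and product topologies, and two elementary facts\<close>

text \<open>Open sets of the pullback are traces on \<open>S\<close> of preimages, so choosing an
  open \<open>V u\<close> for each member \<open>u\<close> turns a cover of \<open>S\<close> into a
  cover of the compact image. The finitely many indices that suffice for the image also suffice for
  \<open>S\<close>.\<close>

lemma compact_space_pullback_euclidean:
  fixes f :: "'b \<Rightarrow> 'c::topological_space"
  assumes "compact (f ` S)"
  shows "compact_space (pullback_topology S f euclidean)"
proof -
  have top: "topspace (pullback_topology S f euclidean) = S"
    by (simp add: topspace_pullback_topology)
  show ?thesis
    unfolding compact_space_def compactin_def top
  proof (intro conjI allI impI)
    fix \<U> assume "(\<forall>u\<in>\<U>. openin (pullback_topology S f euclidean) u) \<and> S \<subseteq> \<Union>\<U>"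
    then have U: "\<forall>u\<in>\<U>. \<exists>V. open V \<and> u = f -` V \<inter> S" and cov: "S \<subseteq> \<Union>\<U>"
      by (auto simp: openin_pullback_topology)
    obtain V where V: "\<And>u. u \<in> \<U> \<Longrightarrow> open (V u)" "\<And>u. u \<in> \<U> \<Longrightarrow> u = f -` V u \<inter> S"
      using U by metis
    have "f ` S \<subseteq> (\<Union>u\<in>\<U>. V u)"
    proof
      fix y assume "y \<in> f ` S"
      then obtain x where x: "x \<in> S" "y = f x" by auto
      then obtain u where "u \<in> \<U>" "x \<in> u" using cov by blast
      then show "y \<in> (\<Union>u\<in>\<U>. V u)" using V(2)[of u] x by auto
    qed
    then obtain F where F: "F \<subseteq> \<U>" "finite F" "f ` S \<subseteq> (\<Union>u\<in>F. V u)"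
      using compactE_image[OF assms, of \<U> V] V(1) by metis
    have "S \<subseteq> \<Union>F"
    proof
      fix x assume x: "x \<in> S"
      then obtain u where u: "u \<in> F" "f x \<in> V u" using F(3) by blast
      with x have "x \<in> f -` V u \<inter> S" by simp
      then have "x \<in> u" using V(2)[of u] u(1) F(1) by blast
      then show "x \<in> \<Union>F" using u by blast
    qed
    then show "\<exists>\<F>. finite \<F> \<and> \<F> \<subseteq> \<U> \<and> S \<subseteq> \<Union>\<F>" using F by blast
  qed (simp add: top)
qed

text \<open>Tychonoff's theorem, transferred to the function type, whose topology is the product
  topology.\<close>

lemma compact_Pi_UNIV:
  fixes K :: "'i \<Rightarrow> 'b::topological_space set"
  assumes "\<And>i. compact (K i)"
  shows "compact {f. \<forall>i. f i \<in> K i}"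
proof -
  have "compactin (product_topology (\<lambda>i. euclidean) UNIV) (PiE UNIV K)"
    using assms by (simp add: compactin_PiE)
  moreover have "PiE UNIV K = {f. \<forall>i. f i \<in> K i}" by (auto simp: PiE_def)
  ultimately show ?thesis by (simp add: euclidean_product_topology)
qed

lemma topspace_C2_topology [simp]: "topspace (C2_topology M) = C2 M"
  by (simp add: C2_topology_def topspace_pullback_topology)

text \<open>Each open \<open>V\<close> of the target yields the open set of points of
  \<open>S\<close> that \<open>f\<close> sends into \<open>V\<close>. The choice
  \<open>V = UNIV\<close> accounts for the condition of being eventually in
  \<open>S\<close>.\<close>

lemma limitin_pullback_euclidean:
  fixes f :: "'b \<Rightarrow> 'c::topological_space"
  shows "limitin (pullback_topology S f euclidean) g l F \<longleftrightarrow>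
    l \<in> S \<and> eventually (\<lambda>i. g i \<in> S) F \<and> ((\<lambda>i. f (g i)) \<longlongrightarrow> f l) F"
proof safe
  assume L: "limitin (pullback_topology S f euclidean) g l F"
  show "l \<in> S" using limitin_topspace[OF L] by (simp add: topspace_pullback_topology)
  have o: "openin (pullback_topology S f euclidean) (f -` V \<inter> S)" if "open V" for V
    using that by (auto simp: openin_pullback_topology)
  show "eventually (\<lambda>i. g i \<in> S) F"
    using L o[of UNIV] \<open>l \<in> S\<close> unfolding limitin_def by auto
  show "((\<lambda>i. f (g i)) \<longlongrightarrow> f l) F"
  proof (rule topological_tendstoI)
    fix V assume "open V" "f l \<in> V"
    then have "eventually (\<lambda>i. g i \<in> f -` V \<inter> S) F"
      using L o[of V] \<open>l \<in> S\<close> unfolding limitin_def by auto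
    then show "eventually (\<lambda>i. f (g i) \<in> V) F" by eventually_elim auto
  qed
next
  assume l: "l \<in> S" and e: "eventually (\<lambda>i. g i \<in> S) F" and t: "((\<lambda>i. f (g i)) \<longlongrightarrow> f l) F"
  show "limitin (pullback_topology S f euclidean) g l F"
    unfolding limitin_def
  proof (intro conjI allI impI)
    show "l \<in> topspace (pullback_topology S f euclidean)"
      using l by (simp add: topspace_pullback_topology)
    fix U assume "openin (pullback_topology S f euclidean) U \<and> l \<in> U"
    then obtain V where V: "open V" "U = f -` V \<inter> S" "f l \<in> V"
      by (auto simp: openin_pullback_topology)
    from topological_tendstoD[OF t V(1,3)] e
    show "eventually (\<lambda>i. g i \<in> U) F" by eventually_elim (use V in auto)
  qed
qed

lemma tendsto_fun_iff:
  fixes f :: "'i \<Rightarrow> 'b \<Rightarrow> 'c::topological_space"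
  shows "(f \<longlongrightarrow> l) F \<longleftrightarrow> (\<forall>x. ((\<lambda>i. f i x) \<longlongrightarrow> l x) F)"
proof -
  have "limitin (product_topology (\<lambda>_::'b. euclidean :: 'c topology) UNIV) f l F \<longleftrightarrow>
      (\<forall>x. ((\<lambda>i. f i x) \<longlongrightarrow> l x) F)"
    by (simp add: limitin_componentwise)
  then show ?thesis by (simp add: euclidean_product_topology)
qed

text \<open>Recovers the convergence that the topology is meant to encode. On pairs that are not
  both measurable \<open>rect_eval\<close> is constantly 0, so these coordinates impose
  nothing.\<close>

lemma limitin_C2_topology:
  "limitin (C2_topology M) g \<rho> F \<longleftrightarrow> \<rho> \<in> C2 M \<and> eventually (\<lambda>i. g i \<in> C2 M) F \<and>
    (\<forall>A\<in>sets M. \<forall>B\<in>sets M. ((\<lambda>i. measure (g i) (A \<times> B)) \<longlongrightarrow> measure \<rho> (A \<times> B)) F)"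
  unfolding C2_topology_def limitin_pullback_euclidean tendsto_fun_iff
  by (auto simp: rect_eval_def)

lemma continuous_map_C2_rectangle:
  assumes "A \<in> sets M" "B \<in> sets M"
  shows "continuous_map (C2_topology M) euclideanreal (\<lambda>\<rho>. measure \<rho> (A \<times> B))"
proof -
  have "continuous_map euclidean euclideanreal (\<lambda>F :: 'a set \<times> 'a set \<Rightarrow> real. F (A, B))"
    by simp
  then have "continuous_map (C2_topology M) euclideanreal ((\<lambda>F. F (A, B)) \<circ> rect_eval M)"
    unfolding C2_topology_def by (rule continuous_map_pullback)
  moreover have "(\<lambda>F. F (A, B)) \<circ> rect_eval M = (\<lambda>\<rho>. measure \<rho> (A \<times> B))"
    using assms by (auto simp: rect_eval_def)
  ultimately show ?thesis by simp
qed

text \<open>Serves to compare a function and its translate through a simple function. The factor 3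
  is correct because the defect of the real inequality is a sum of three squares of
  differences.\<close>

lemma norm_diff_sq_le_3:
  fixes a b c d :: complex
  shows "(cmod (a - d))\<^sup>2 \<le> 3 * ((cmod (a - b))\<^sup>2 + (cmod (b - c))\<^sup>2 + (cmod (c - d))\<^sup>2)"
proof -
  have "cmod (a - d) \<le> cmod (a - b) + cmod (b - c) + cmod (c - d)"
    using norm_triangle_ineq[of "a - b" "b - c"] norm_triangle_ineq[of "a - c" "c - d"] by simp
  then have "(cmod (a - d))\<^sup>2 \<le> (cmod (a - b) + cmod (b - c) + cmod (c - d))\<^sup>2"
    by (simp add: power_mono)
  also have "\<dots> \<le> 3 * ((cmod (a - b))\<^sup>2 + (cmod (b - c))\<^sup>2 + (cmod (c - d))\<^sup>2)"
  proof -
    have "(x + y + z)\<^sup>2 \<le> 3 * (x\<^sup>2 + y\<^sup>2 + z\<^sup>2)" for x y z :: real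
      using sum_squares_ge_zero[of "x - y" "y - z"] zero_le_power2[of "x - z"]
      by (simp add: power2_eq_square algebra_simps)
    then show ?thesis .
  qed
  finally show ?thesis .
qed

lemma top_rigid_imp_pointwise_recurrent:
  assumes "top_rigid X R"
  shows "pointwise_recurrent X R"
  unfolding pointwise_recurrent_def
proof (intro ballI allI impI)
  fix x U assume x: "x \<in> topspace X" and U: "openin X U \<and> x \<in> U"
  obtain n :: "nat \<Rightarrow> nat" where n: "strict_mono n" "limitin X (\<lambda>i. (R ^^ n i) x) x sequentially"
    using assms x by (auto simp: top_rigid_def)
  then obtain N where N: "\<And>i. i \<ge> N \<Longrightarrow> (R ^^ n i) x \<in> U"
    using U unfolding limitin_sequentially by blast
  have "inj_on n {N..}" using n(1) strict_mono_imp_inj_on inj_on_subset by blast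
  then have "infinite (n ` {N..})" by (simp add: finite_image_iff infinite_Ici)
  then show "infinite {n. (R ^^ n) x \<in> U}" using N by (elim infinite_super[rotated]) auto
qed

section \<open>Couplings of a Borel probability measure on a Polish space\<close>

locale polish_prob_space = prob_space M for M :: "'a::polish_space measure" +
  assumes sets_eq_borel: "sets M = sets borel"
begin

lemma space_eq_UNIV [simp]: "space M = UNIV"
  using sets_eq_imp_space_eq[OF sets_eq_borel] by simp

lemma UNIV_in_sets [simp]: "UNIV \<in> sets M"
  using sets.top[of M] by simp

lemma prob_UNIV [simp]: "prob UNIV = 1"
  using prob_space by simp

lemma C2_prob_space: "\<rho> \<in> C2 M \<Longrightarrow> prob_space \<rho>"
  and C2_sets: "\<rho> \<in> C2 M \<Longrightarrow> sets \<rho> = sets (M \<Otimes>\<^sub>M M)"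
  by (auto simp: C2_def)

lemma C2_space: "\<rho> \<in> C2 M \<Longrightarrow> space \<rho> = UNIV"
  using sets_eq_imp_space_eq[OF C2_sets] by (simp add: space_pair_measure)

lemma C2_rectangle_sets: "\<rho> \<in> C2 M \<Longrightarrow> A \<in> sets M \<Longrightarrow> B \<in> sets M \<Longrightarrow> A \<times> B \<in> sets \<rho>"
  by (simp add: C2_sets)

lemma C2_emeasure_marginals:
  assumes "\<rho> \<in> C2 M" "A \<in> sets M"
  shows "emeasure \<rho> (A \<times> UNIV) = emeasure M A" "emeasure \<rho> (UNIV \<times> A) = emeasure M A"
proof -
  have d: "distr \<rho> M fst = M" "distr \<rho> M snd = M" using assms by (auto simp: C2_def)
  have m: "fst \<in> \<rho> \<rightarrow>\<^sub>M M" "snd \<in> \<rho> \<rightarrow>\<^sub>M M"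
    using assms by (auto simp: measurable_cong_sets[OF C2_sets refl])
  have "emeasure M A = emeasure \<rho> (fst -` A \<inter> space \<rho>)"
    using emeasure_distr[OF m(1) assms(2)] d by simp
  moreover have "fst -` A \<inter> space \<rho> = A \<times> UNIV" using assms by (auto simp: C2_space)
  ultimately show "emeasure \<rho> (A \<times> UNIV) = emeasure M A" by simp
  have "emeasure M A = emeasure \<rho> (snd -` A \<inter> space \<rho>)"
    using emeasure_distr[OF m(2) assms(2)] d by simp
  moreover have "snd -` A \<inter> space \<rho> = UNIV \<times> A" using assms by (auto simp: C2_space)
  ultimately show "emeasure \<rho> (UNIV \<times> A) = emeasure M A" by simp
qed

lemma C2_marginals:
  assumes "\<rho> \<in> C2 M" "A \<in> sets M"
  shows "measure \<rho> (A \<times> UNIV) = prob A" "measure \<rho> (UNIV \<times> A) = prob A"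
  using C2_emeasure_marginals[OF assms] by (auto simp: measure_def)

text \<open>Total mass one needs no separate check: it is the first marginal condition at
  \<open>UNIV\<close>.\<close>

lemma C2I:
  assumes s: "sets \<rho> = sets (M \<Otimes>\<^sub>M M)"
    and m: "\<And>A. A \<in> sets M \<Longrightarrow> emeasure \<rho> (A \<times> UNIV) = emeasure M A"
      "\<And>A. A \<in> sets M \<Longrightarrow> emeasure \<rho> (UNIV \<times> A) = emeasure M A"
  shows "\<rho> \<in> C2 M"
proof -
  have sp: "space \<rho> = UNIV" using sets_eq_imp_space_eq[OF s] by (simp add: space_pair_measure)
  have ms: "fst \<in> \<rho> \<rightarrow>\<^sub>M M" "snd \<in> \<rho> \<rightarrow>\<^sub>M M"
    by (auto simp: measurable_cong_sets[OF s refl])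
  have v: "fst -` A \<inter> space \<rho> = A \<times> UNIV" "snd -` A \<inter> space \<rho> = UNIV \<times> A" for A :: "'a set"
    by (auto simp: sp)
  have "distr \<rho> M fst = M" "distr \<rho> M snd = M"
    by (auto intro!: measure_eqI simp: emeasure_distr[OF ms(1)] emeasure_distr[OF ms(2)] v m)
  moreover have "prob_space \<rho>"
    using m(1)[of UNIV] emeasure_space_1 by (auto intro!: prob_spaceI simp: sp)
  ultimately show ?thesis using s by (simp add: C2_def)
qed

text \<open>The larger product is contained in \<open>A \<times> B\<close> together with the strips
  over \<open>A' - A\<close> and \<open>B' - B\<close>, and the mass of a strip is fixed by a
  marginal. Hence the bound does not depend on the coupling.\<close>

lemma C2_rectangle_perturb:
  assumes \<rho>: "\<rho> \<in> C2 M" and s: "A \<in> sets M" "B \<in> sets M" "A' \<in> sets M" "B' \<in> sets M"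
  shows "measure \<rho> (A' \<times> B') \<le> measure \<rho> (A \<times> B) + prob (A' - A) + prob (B' - B)"
proof -
  interpret \<rho>: prob_space \<rho> using \<rho> by (rule C2_prob_space)
  have "measure \<rho> (A' \<times> B') \<le> measure \<rho> (A \<times> B \<union> (A' - A) \<times> UNIV \<union> UNIV \<times> (B' - B))"
    using s by (intro \<rho>.finite_measure_mono) (auto intro!: sets.Un C2_rectangle_sets[OF \<rho>])
  also have "\<dots> \<le> measure \<rho> (A \<times> B) + measure \<rho> ((A' - A) \<times> UNIV) + measure \<rho> (UNIV \<times> (B' - B))"
    using s by (intro order_trans[OF measure_Un_le] add_mono measure_Un_le)
      (auto intro!: sets.Un C2_rectangle_sets[OF \<rho>])
  finally show ?thesis using s by (simp add: C2_marginals[OF \<rho>])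
qed

section \<open>Compactness of the space of couplings\<close>

text \<open>Inner regularity of finite Borel measures on Polish spaces.\<close>

lemma ex_compact_approx:
  assumes "A \<in> sets M" "e > 0"
  obtains K where "compact K" "K \<subseteq> A" "K \<in> sets M" "prob (A - K) < e"
proof -
  have 1: "emeasure M A = (SUP K \<in> {K. K \<subseteq> A \<and> compact K}. emeasure M K)"
    using assms(1) by (intro inner_regular[OF sets_eq_borel]) (auto simp: sets_eq_borel)
  have 2: "{K. K \<subseteq> A \<and> compact K} \<noteq> {}" by auto
  have "\<exists>K\<in>{K. K \<subseteq> A \<and> compact K}. emeasure M A < emeasure M K + ennreal e"
    by (rule SUP_approx_ennreal[OF assms(2) 2 1]) simp
  then obtain K where K: "K \<subseteq> A" "compact K" "emeasure M A < emeasure M K + ennreal e" by blast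
  have Ks: "K \<in> sets M" using K by (simp add: sets_eq_borel borel_compact)
  have "prob A < prob K + e"
    using K(3) assms(2) by (simp add: emeasure_eq_measure ennreal_less_iff flip: ennreal_plus)
  then have "prob (A - K) < e" using K Ks assms by (simp add: finite_measure_Diff)
  then show thesis using that K Ks by blast
qed

text \<open>Outer regularity, obtained by complementing a compact set inside
  \<open>- A\<close>.\<close>

lemma ex_open_approx:
  assumes "A \<in> sets M" "e > 0"
  obtains U where "open U" "A \<subseteq> U" "U \<in> sets M" "prob (U - A) < e"
proof -
  have As: "- A \<in> sets M" using assms(1) sets.compl_sets[of A M] by (simp add: Compl_eq_Diff_UNIV)
  obtain K where K: "compact K" "K \<subseteq> - A" "K \<in> sets M" "prob (- A - K) < e"
    using ex_compact_approx[OF As assms(2)] .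
  show thesis
  proof
    show "open (- K)" using K(1) by (simp add: compact_imp_closed open_Compl)
    show "- K \<in> sets M" using K(3) sets.compl_sets[of K M] by (simp add: Compl_eq_Diff_UNIV)
    have "- K - A = - A - K" by auto
    then show "prob (- K - A) < e" using K(4) by simp
  qed (use K in auto)
qed

text \<open>Each property involves only finitely many coordinates of \<open>F\<close>, so it cuts
  out a closed set of functions. It holds for genuine couplings and therefore survives in the
  closure.\<close>

lemma closure_rect_eval_C2:
  assumes F: "F \<in> closure (rect_eval M ` C2 M)"
  shows rect_closure_zero: "\<not> (A \<in> sets M \<and> B \<in> sets M) \<Longrightarrow> F (A, B) = 0"
    and rect_closure_marginals: "A \<in> sets M \<Longrightarrow> F (A, UNIV) = prob A" "A \<in> sets M \<Longrightarrow> F (UNIV, A) = prob A"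
    and rect_closure_nonneg: "0 \<le> F (A, B)"
    and rect_closure_disjoint: "finite I \<Longrightarrow> (\<And>i. i \<in> I \<Longrightarrow> P i \<in> sets M \<and> Q i \<in> sets M) \<Longrightarrow> A \<in> sets M \<Longrightarrow>
       B \<in> sets M \<Longrightarrow> disjoint_family_on (\<lambda>i. P i \<times> Q i) I \<Longrightarrow> (\<Union>i\<in>I. P i \<times> Q i) \<subseteq> A \<times> B \<Longrightarrow>
       (\<Sum>i\<in>I. F (P i, Q i)) \<le> F (A, B)"
    and rect_closure_cover: "finite I \<Longrightarrow> (\<And>i. i \<in> I \<Longrightarrow> P i \<in> sets M \<and> Q i \<in> sets M) \<Longrightarrow> A \<in> sets M \<Longrightarrow>
       B \<in> sets M \<Longrightarrow> A \<times> B \<subseteq> (\<Union>i\<in>I. P i \<times> Q i) \<Longrightarrow>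
       F (A, B) \<le> (\<Sum>i\<in>I. F (P i, Q i))"
    and rect_closure_perturb: "A \<in> sets M \<Longrightarrow> B \<in> sets M \<Longrightarrow> A' \<in> sets M \<Longrightarrow> B' \<in> sets M \<Longrightarrow>
       F (A', B') \<le> F (A, B) + prob (A' - A) + prob (B' - B)"
proof -
  \<comment> \<open>The transfer principle behind all six claims: a closed condition valid on the
    image holds at every point of its closure.\<close>
  have P: "R F" if "closed {F. R F}" "\<And>\<rho>. \<rho> \<in> C2 M \<Longrightarrow> R (rect_eval M \<rho>)" for R
    using closure_minimal[of "rect_eval M ` C2 M" "{F. R F}"] that F by auto
  note cl = closed_Collect_le closed_Collect_eq continuous_intros
  show "F (A, B) = 0" if "\<not> (A \<in> sets M \<and> B \<in> sets M)"
    by (rule P[of "\<lambda>F. F (A, B) = 0"]) (use that in \<open>auto simp: rect_eval_def intro!: cl\<close>)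
  show "F (A, UNIV) = prob A" if "A \<in> sets M"
    by (rule P[of "\<lambda>F. F (A, UNIV) = prob A"])
      (use that in \<open>auto simp: rect_eval_def C2_marginals intro!: cl\<close>)
  show "F (UNIV, A) = prob A" if "A \<in> sets M"
    by (rule P[of "\<lambda>F. F (UNIV, A) = prob A"])
      (use that in \<open>auto simp: rect_eval_def C2_marginals intro!: cl\<close>)
  show "0 \<le> F (A, B)"
    by (rule P[of "\<lambda>F. 0 \<le> F (A, B)"]) (auto simp: rect_eval_def intro!: cl)
  show "(\<Sum>i\<in>I. F (P i, Q i)) \<le> F (A, B)"
    if "finite I" "\<And>i. i \<in> I \<Longrightarrow> P i \<in> sets M \<and> Q i \<in> sets M" "A \<in> sets M" "B \<in> sets M"
      "disjoint_family_on (\<lambda>i. P i \<times> Q i) I" "(\<Union>i\<in>I. P i \<times> Q i) \<subseteq> A \<times> B"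
  proof (rule P[of "\<lambda>F. (\<Sum>i\<in>I. F (P i, Q i)) \<le> F (A, B)"])
    fix \<rho> assume \<rho>: "\<rho> \<in> C2 M"
    interpret \<rho>: prob_space \<rho> using \<rho> by (rule C2_prob_space)
    have "(\<Sum>i\<in>I. measure \<rho> (P i \<times> Q i)) = measure \<rho> (\<Union>i\<in>I. P i \<times> Q i)"
      using that by (intro \<rho>.finite_measure_finite_Union[symmetric]) (auto intro!: C2_rectangle_sets[OF \<rho>])
    also have "\<dots> \<le> measure \<rho> (A \<times> B)"
      using that by (intro \<rho>.finite_measure_mono) (auto intro!: C2_rectangle_sets[OF \<rho>])
    finally show "(\<Sum>i\<in>I. rect_eval M \<rho> (P i, Q i)) \<le> rect_eval M \<rho> (A, B)"
      using that by (simp add: rect_eval_def)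
  qed (auto intro!: cl)
  show "F (A, B) \<le> (\<Sum>i\<in>I. F (P i, Q i))"
    if "finite I" "\<And>i. i \<in> I \<Longrightarrow> P i \<in> sets M \<and> Q i \<in> sets M" "A \<in> sets M" "B \<in> sets M"
      "A \<times> B \<subseteq> (\<Union>i\<in>I. P i \<times> Q i)"
  proof (rule P[of "\<lambda>F. F (A, B) \<le> (\<Sum>i\<in>I. F (P i, Q i))"])
    fix \<rho> assume \<rho>: "\<rho> \<in> C2 M"
    interpret \<rho>: prob_space \<rho> using \<rho> by (rule C2_prob_space)
    have "measure \<rho> (A \<times> B) \<le> measure \<rho> (\<Union>i\<in>I. P i \<times> Q i)"
      using that by (intro \<rho>.finite_measure_mono) (auto intro!: C2_rectangle_sets[OF \<rho>] sets.finite_UN)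
    also have "\<dots> \<le> (\<Sum>i\<in>I. measure \<rho> (P i \<times> Q i))"
      using that by (intro measure_subadditive_finite \<rho>.emeasure_finite)
        (auto intro!: C2_rectangle_sets[OF \<rho>])
    finally show "rect_eval M \<rho> (A, B) \<le> (\<Sum>i\<in>I. rect_eval M \<rho> (P i, Q i))"
      using that by (simp add: rect_eval_def)
  qed (auto intro!: cl)
  show "F (A', B') \<le> F (A, B) + prob (A' - A) + prob (B' - B)"
    if "A \<in> sets M" "B \<in> sets M" "A' \<in> sets M" "B' \<in> sets M"
    by (rule P[of "\<lambda>F. F (A', B') \<le> F (A, B) + prob (A' - A) + prob (B' - B)"])
      (use that C2_rectangle_perturb in \<open>auto simp: rect_eval_def intro!: cl\<close>)
qed

text \<open>Inner regularity of the marginals replaces Prokhorov's theorem: finite additivity survives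
  the pointwise limit, and compact rectangles turn countable covers into finite ones.\<close>

lemma rect_closure_sums:
  assumes F: "F \<in> closure (rect_eval M ` C2 M)"
    and PQ: "\<And>n::nat. P n \<in> sets M" "\<And>n. Q n \<in> sets M" and AB: "A \<in> sets M" "B \<in> sets M"
    and disj: "disjoint_family (\<lambda>n. P n \<times> Q n)" and un: "(\<Union>n. P n \<times> Q n) = A \<times> B"
  shows "(\<lambda>n. F (P n, Q n)) sums F (A, B)"
proof -
  have part: "(\<Sum>n\<in>I. F (P n, Q n)) \<le> F (A, B)" if "finite I" for I
    using that PQ AB disj un
    by (intro rect_closure_disjoint[OF F]) (blast | simp add: disjoint_family_on_def)+
  have nn: "0 \<le> F (P n, Q n)" for n by (rule rect_closure_nonneg[OF F])
  have summ: "summable (\<lambda>n. F (P n, Q n))"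
    using nn part by (intro summableI_nonneg_bounded[where x="F (A, B)"]) auto
  have le: "(\<Sum>n. F (P n, Q n)) \<le> F (A, B)"
    using part by (intro suminf_le_const summ) auto
  have "F (A, B) \<le> (\<Sum>n. F (P n, Q n)) + e" if "e > 0" for e
  proof -
    \<comment> \<open>The losses add up to \<open>6 * d\<close>: one \<open>d\<close> for each
      compact approximation, and \<open>4 * d\<close> for the open enlargements, namely
      \<open>2 * d * (1/2) ^ n\<close> summed over \<open>n\<close>.\<close>
    define d where "d = e / 8"
    have d: "d > 0" using that by (simp add: d_def)
    obtain K where K: "compact K" "K \<subseteq> A" "K \<in> sets M" "prob (A - K) < d"
      using ex_compact_approx[OF AB(1) d] .
    obtain L where L: "compact L" "L \<subseteq> B" "L \<in> sets M" "prob (B - L) < d"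
      using ex_compact_approx[OF AB(2) d] .
    have dn: "d * (1/2) ^ n > 0" for n using d by simp
    have "\<exists>U. open U \<and> P n \<subseteq> U \<and> U \<in> sets M \<and> prob (U - P n) < d * (1/2) ^ n" for n
      using ex_open_approx[OF PQ(1) dn] by metis
    then obtain U where U: "\<And>n. open (U n)" "\<And>n. P n \<subseteq> U n" "\<And>n. U n \<in> sets M"
        "\<And>n. prob (U n - P n) < d * (1/2) ^ n" by metis
    have "\<exists>U. open U \<and> Q n \<subseteq> U \<and> U \<in> sets M \<and> prob (U - Q n) < d * (1/2) ^ n" for n
      using ex_open_approx[OF PQ(2) dn] by metis
    then obtain V where V: "\<And>n. open (V n)" "\<And>n. Q n \<subseteq> V n" "\<And>n. V n \<in> sets M"
        "\<And>n. prob (V n - Q n) < d * (1/2) ^ n" by metis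
    \<comment> \<open>The compact rectangle is covered by open ones, so finitely many suffice. From
      there only finite subadditivity of \<open>F\<close> is used.\<close>
    have "K \<times> L \<subseteq> (\<Union>n. P n \<times> Q n)" using K L un by auto
    also have "\<dots> \<subseteq> (\<Union>n\<in>UNIV. U n \<times> V n)" using U(2) V(2) by blast
    finally have cov: "K \<times> L \<subseteq> (\<Union>n\<in>UNIV. U n \<times> V n)" .
    have op: "open (U n \<times> V n)" for n using U(1) V(1) by (rule open_Times)
    obtain I where I: "I \<subseteq> UNIV" "finite I" "K \<times> L \<subseteq> (\<Union>n\<in>I. U n \<times> V n)"
      by (rule compactE_image[OF compact_Times[OF K(1) L(1)] op cov])
    have geo: "(\<lambda>n. d * (1/2::real) ^ n) sums (d * 2)"
      using sums_mult[OF geometric_sums[of "1/2::real"], of d] by simp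
    have "F (A, B) \<le> F (K, L) + prob (A - K) + prob (B - L)"
      by (intro rect_closure_perturb[OF F] AB K L)
    also have "F (K, L) \<le> (\<Sum>n\<in>I. F (U n, V n))"
      using U V by (intro rect_closure_cover[OF F] K L I) auto
    also have "(\<Sum>n\<in>I. F (U n, V n)) \<le> (\<Sum>n\<in>I. F (P n, Q n) + 2 * (d * (1/2) ^ n))"
    proof (rule sum_mono)
      fix n
      have "F (U n, V n) \<le> F (P n, Q n) + prob (U n - P n) + prob (V n - Q n)"
        by (intro rect_closure_perturb[OF F] PQ U V)
      then show "F (U n, V n) \<le> F (P n, Q n) + 2 * (d * (1/2) ^ n)"
        using U(4)[of n] V(4)[of n] by simp
    qed
    also have "\<dots> = (\<Sum>n\<in>I. F (P n, Q n)) + 2 * (\<Sum>n\<in>I. d * (1/2) ^ n)"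
      by (simp add: sum.distrib sum_distrib_left)
    also have "(\<Sum>n\<in>I. F (P n, Q n)) \<le> (\<Sum>n. F (P n, Q n))"
      using nn by (intro sum_le_suminf summ I) auto
    also have "(\<Sum>n\<in>I. d * (1/2) ^ n) \<le> (\<Sum>n. d * (1/2) ^ n)"
      using d geo by (intro sum_le_suminf I) (auto simp: sums_iff)
    also have "(\<Sum>n. d * (1/2) ^ n) = d * 2" using geo by (simp add: sums_iff)
    finally show ?thesis using K(4) L(4) that by (simp add: d_def)
  qed
  then have "F (A, B) \<le> (\<Sum>n. F (P n, Q n))" by (rule field_le_epsilon)
  with le summ show ?thesis by (simp add: sums_iff)
qed

text \<open>Prepares the Caratheodory extension from rectangles.\<close>

lemma semiring_rectangles: "semiring_of_sets UNIV {A \<times> B | A B. A \<in> sets M \<and> B \<in> sets M}"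
proof
  let ?R = "{A \<times> B | A B. A \<in> sets M \<and> B \<in> sets M}"
  show "?R \<subseteq> Pow UNIV" by auto
  show "{} \<in> ?R" by blast
  fix a b assume "a \<in> ?R" "b \<in> ?R"
  then obtain A B C D where a: "a = A \<times> B" "A \<in> sets M" "B \<in> sets M"
    and b: "b = C \<times> D" "C \<in> sets M" "D \<in> sets M" by auto
  have "a \<inter> b = (A \<inter> C) \<times> (B \<inter> D)" using a b by auto
  then show "a \<inter> b \<in> ?R" using a b by blast
  \<comment> \<open>The difference is cut by the first coordinate: outside \<open>C\<close> all of
    \<open>B\<close> remains, inside \<open>C\<close> only \<open>B - D\<close>.\<close>
  let ?C = "{(A - C) \<times> B, (A \<inter> C) \<times> (B - D)}"
  have "(A - C) \<times> B \<in> ?R" "(A \<inter> C) \<times> (B - D) \<in> ?R"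
    using a(2,3) b(2,3) by blast+
  then have "?C \<subseteq> ?R" by simp
  moreover have "disjoint ?C" by (auto simp: disjoint_def)
  moreover have "a - b = \<Union>?C" using a b by auto
  ultimately show "\<exists>C\<subseteq>?R. finite C \<and> disjoint C \<and> a - b = \<Union>C" by blast
qed

text \<open>A limit \<open>F\<close> of rectangle evaluations is countably additive on rectangles by
  \<open>rect_closure_sums\<close>. Caratheodory extension then produces a measure with these
  values, and its marginals are read off from \<open>F\<close>.\<close>

lemma closed_rect_eval_C2: "closed (rect_eval M ` C2 M)"
proof -
  have "F \<in> rect_eval M ` C2 M" if F: "F \<in> closure (rect_eval M ` C2 M)" for F
  proof -
    define \<rho> where "\<rho> = extend_measure UNIV {(A, B). A \<in> sets M \<and> B \<in> sets M} (\<lambda>(A, B). A \<times> B)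
      (\<lambda>(A, B). ennreal (F (A, B)))"
    have em: "emeasure \<rho> (A \<times> B) = ennreal (F (A, B))" if "A \<in> sets M" "B \<in> sets M" for A B
    proof (rule extend_measure_caratheodory_pair[OF \<rho>_def])
      show "semiring_of_sets UNIV {A \<times> B | A B. A \<in> sets M \<and> B \<in> sets M}"
        by (rule semiring_rectangles)
    next
      fix A B assume "A \<in> sets M \<and> B \<in> sets M" "A \<times> B = {}"
      \<comment> \<open>An empty product is covered by the empty family, whose sum is 0.\<close>
      then have "F (A, B) \<le> 0"
        using rect_closure_cover[OF F, of "{} :: nat set" "\<lambda>_. {}" "\<lambda>_. {}" A B] by simp
      then show "ennreal (F (A, B)) = 0" by (simp add: ennreal_neg)
    next
      fix A B C D assume "A \<in> sets M \<and> B \<in> sets M" "C \<in> sets M \<and> D \<in> sets M" "A \<times> B = C \<times> D"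
      \<comment> \<open>Different pairs may have the same product when it is empty. Covering each
        product by the other as a one-element family shows that the value is well defined.\<close>
      then have "F (A, B) \<le> F (C, D)" "F (C, D) \<le> F (A, B)"
        using rect_closure_cover[OF F, of "{()}" "\<lambda>_. C" "\<lambda>_. D" A B]
          rect_closure_cover[OF F, of "{()}" "\<lambda>_. A" "\<lambda>_. B" C D] by auto
      then show "ennreal (F (A, B)) = ennreal (F (C, D))" by simp
    next
      fix P Q A B assume *: "\<And>n::nat. P n \<in> sets M \<and> Q n \<in> sets M" "A \<in> sets M \<and> B \<in> sets M"
        "disjoint_family (\<lambda>n. P n \<times> Q n)" "(\<Union>n. P n \<times> Q n) = A \<times> B"
      then have "(\<lambda>n. F (P n, Q n)) sums F (A, B)"
        by (intro rect_closure_sums[OF F]) auto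
      then show "(\<Sum>n. ennreal (F (P n, Q n))) = ennreal (F (A, B))"
        by (intro suminf_ennreal_eq rect_closure_nonneg[OF F])
    qed (use that in auto)
    have im: "(\<lambda>(A, B). A \<times> B) ` {(A, B). A \<in> sets M \<and> B \<in> sets M} =
        {A \<times> B | A B. A \<in> sets M \<and> B \<in> sets M}" by auto
    have "sets \<rho> = sigma_sets UNIV ((\<lambda>(A, B). A \<times> B) ` {(A, B). A \<in> sets M \<and> B \<in> sets M})"
      unfolding \<rho>_def by (rule sets_extend_measure) simp
    then have s: "sets \<rho> = sets (M \<Otimes>\<^sub>M M)"
      unfolding im by (simp add: sets_pair_measure)
    have "\<rho> \<in> C2 M"
      by (rule C2I[OF s]) (simp_all add: em rect_closure_marginals[OF F] emeasure_eq_measure)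
    moreover have "rect_eval M \<rho> = F"
    proof (rule ext, clarify)
      fix A B show "rect_eval M \<rho> (A, B) = F (A, B)"
        using em[of A B] rect_closure_zero[OF F, of A B] rect_closure_nonneg[OF F, of A B]
        by (auto simp: rect_eval_def measure_def)
    qed
    ultimately show ?thesis by blast
  qed
  then show ?thesis by (metis closure_subset_eq subsetI)
qed

text \<open>The image under \<open>rect_eval\<close> is a closed subset of a cube of unit intervals,
  which is compact by Tychonoff.\<close>

lemma compact_space_C2: "compact_space (C2_topology M)"
  unfolding C2_topology_def
proof (rule compact_space_pullback_euclidean)
  have "rect_eval M ` C2 M \<subseteq> {F. \<forall>p. F p \<in> {0..1}}"
    by (auto simp: rect_eval_def C2_prob_space prob_space.prob_le_1)
  moreover have "compact {F :: 'a set \<times> 'a set \<Rightarrow> real. \<forall>p. F p \<in> {0..1}}"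
    by (rule compact_Pi_UNIV) simp
  ultimately show "compact (rect_eval M ` C2 M)"
    using closed_rect_eval_C2 compact_Int_closed by (metis inf.absorb_iff2)
qed

section \<open>Countable generators and metrizability of the space of couplings\<close>

text \<open>Finite intersections of a countable basis form a countable family that is closed under
  intersection, as the uniqueness theorem for measures requires.\<close>

lemma ex_countable_generator:
  obtains \<G> :: "nat \<Rightarrow> 'a set" where "sets M = sigma_sets UNIV (range \<G>)" "Int_stable (range \<G>)" "UNIV \<in> range \<G>"
proof -
  obtain B :: "'a set set" where B: "countable B" "topological_basis B"
    using ex_countable_basis by blast
  define E where "E = Inter ` {F. finite F \<and> F \<subseteq> B}"
  have cE: "countable E" unfolding E_def using B(1) by (intro countable_image countable_Collect_finite_subset)
  \<comment> \<open>The whole space enters as the intersection of the empty family.\<close>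
  have top: "UNIV \<in> E" unfolding E_def by (rule image_eqI[of _ _ "{}"]) auto
  then have r: "range (from_nat_into E) = E" using cE by (intro range_from_nat_into) auto
  have stable: "Int_stable E"
  proof (rule Int_stableI)
    fix a b assume "a \<in> E" "b \<in> E"
    then obtain F G where "finite F" "F \<subseteq> B" "a = \<Inter>F" "finite G" "G \<subseteq> B" "b = \<Inter>G" by (auto simp: E_def)
    then show "a \<inter> b \<in> E" unfolding E_def by (intro image_eqI[of _ _ "F \<union> G"]) auto
  qed
  have bs: "B \<subseteq> sets borel" using topological_basis_open[OF B(2)] by auto
  have "sets M = sigma_sets UNIV B"
    unfolding sets_eq_borel borel_eq_countable_basis[OF B] by simp
  also have "\<dots> = sigma_sets UNIV E"
  proof (rule sigma_sets_eqI)
    fix a assume "a \<in> B"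
    then have "a \<in> E" unfolding E_def by (intro image_eqI[of _ _ "{a}"]) auto
    then show "a \<in> sigma_sets UNIV E" by auto
  next
    fix b assume "b \<in> E"
    then obtain F where F: "finite F" "F \<subseteq> B" "b = \<Inter>F" by (auto simp: E_def)
    have "open b" unfolding F(3) using F topological_basis_open[OF B(2)] by (intro open_Inter) auto
    then have "b \<in> sets borel" by simp
    then show "b \<in> sigma_sets UNIV B" unfolding borel_eq_countable_basis[OF B] by simp
  qed
  finally show thesis using that[of "from_nat_into E"] stable top by (simp add: r)
qed

text \<open>The masses of the countably many generator rectangles determine a coupling. They define
  a continuous injection of a compact space into a countable product of real lines, which is closed
  and hence an embedding into a metrizable space.\<close>

lemma metrizable_space_C2: "metrizable_space (C2_topology M)"
proof -
  obtain \<G> :: "nat \<Rightarrow> 'a set" where \<G>: "sets M = sigma_sets UNIV (range \<G>)" "Int_stable (range \<G>)"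
    "UNIV \<in> range \<G>" by (rule ex_countable_generator)
  have \<G>s: "\<G> k \<in> sets M" for k unfolding \<G>(1) by auto
  define G where "G = (\<lambda>\<rho> (k, l). measure \<rho> (\<G> k \<times> \<G> l))"
  have "continuous_map (C2_topology M) (product_topology (\<lambda>_. euclideanreal) UNIV) G"
    unfolding continuous_map_componentwise_UNIV
  proof
    fix p :: "nat \<times> nat"
    show "continuous_map (C2_topology M) euclideanreal (\<lambda>\<rho>. G \<rho> p)"
      using continuous_map_C2_rectangle[OF \<G>s \<G>s, of "fst p" "snd p"] by (simp add: G_def case_prod_unfold)
  qed
  then have cont: "continuous_map (C2_topology M) euclidean G"
    by (simp add: euclidean_product_topology)
  have inj: "inj_on G (C2 M)"
  proof (rule inj_onI)
    fix \<rho> \<sigma> assume \<rho>: "\<rho> \<in> C2 M" and \<sigma>: "\<sigma> \<in> C2 M" and eq: "G \<rho> = G \<sigma>"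
    interpret \<rho>: prob_space \<rho> using \<rho> by (rule C2_prob_space)
    interpret \<sigma>: prob_space \<sigma> using \<sigma> by (rule C2_prob_space)
    let ?E = "{a \<times> b | a b. a \<in> range \<G> \<and> b \<in> range \<G>}"
    have "sets (M \<Otimes>\<^sub>M M) = sets (sigma (space M \<times> space M) ?E)"
      using \<G> by (intro sets_pair_eq[where Ca="{UNIV}" and Cb="{UNIV}"]) auto
    then have s: "sets (M \<Otimes>\<^sub>M M) = sigma_sets UNIV ?E" by simp
    show "\<rho> = \<sigma>"
    proof (rule measure_eqI_generator_eq)
      show "Int_stable ?E"
      proof (rule Int_stableI)
        fix x y assume "x \<in> ?E" "y \<in> ?E"
        then obtain a b c d where *: "x = a \<times> b" "y = c \<times> d" "a \<in> range \<G>" "b \<in> range \<G>" "c \<in> range \<G>" "d \<in> range \<G>"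
          by auto
        then have "a \<inter> c \<in> range \<G>" "b \<inter> d \<in> range \<G>" using \<G>(2) by (auto simp: Int_stable_def)
        moreover have "x \<inter> y = (a \<inter> c) \<times> (b \<inter> d)" using * by auto
        ultimately show "x \<inter> y \<in> ?E" by blast
      qed
      show "sets \<rho> = sigma_sets UNIV ?E" "sets \<sigma> = sigma_sets UNIV ?E"
        using C2_sets[OF \<rho>] C2_sets[OF \<sigma>] s by auto
      show "emeasure \<rho> X = emeasure \<sigma> X" if "X \<in> ?E" for X
      proof -
        from that obtain k l where "X = \<G> k \<times> \<G> l" by auto
        then show ?thesis using fun_cong[OF eq, of "(k, l)"]
          by (simp add: G_def \<rho>.emeasure_eq_measure \<sigma>.emeasure_eq_measure)
      qed
      have "UNIV = (UNIV::'a set) \<times> (UNIV::'a set)" by auto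
      then show "range (\<lambda>i::nat. UNIV) \<subseteq> ?E" using \<G>(3) by blast
    qed auto
  qed
  have "closed_map (C2_topology M) euclidean G"
    by (rule continuous_imp_closed_map[OF cont compact_space_C2]) simp
  then have "embedding_map (C2_topology M) euclidean G"
    using cont inj by (intro injective_closed_imp_embedding_map) auto
  then have "C2_topology M homeomorphic_space subtopology euclidean (G ` C2 M)"
    using embedding_map_imp_homeomorphic_space by fastforce
  moreover have "metrizable_space (subtopology euclidean (G ` C2 M))"
    by (intro metrizable_space_subtopology metrizable_space_euclidean)
  ultimately show ?thesis using homeomorphic_metrizable_space by blast
qed

text \<open>Ensures that a uniform rigidity statement quantified over all compatible metrics is not
  vacuous.\<close>

lemma ex_metric_C2: "\<exists>d. Metric_space (C2 M) d \<and> Metric_space.mtopology (C2 M) d = C2_topology M"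
proof -
  obtain S d where d: "Metric_space S d" "C2_topology M = Metric_space.mtopology S d"
    using metrizable_space_C2 by (auto simp: metrizable_space_def)
  have "S = C2 M" using Metric_space.topspace_mtopology[OF d(1)] d(2) by (metis topspace_C2_topology)
  then show ?thesis using d by auto
qed

end

section \<open>Iterates of an automorphism and of its lens\<close>

locale polish_automorphism = polish_prob_space M for M :: "'a::polish_space measure" +
  fixes T :: "'a \<Rightarrow> 'a"
  assumes aut: "aut M T"
begin

lemma T_measurable [measurable]: "T \<in> M \<rightarrow>\<^sub>M M" and distr_T: "distr M M T = M"
  using aut by (auto simp: aut_def)

lemma funpow_measurable [measurable]: "T ^^ n \<in> M \<rightarrow>\<^sub>M M"
proof (induction n)
  case (Suc n)
  then show ?case using measurable_comp[OF Suc T_measurable] by simp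
qed simp

lemma distr_funpow: "distr M M (T ^^ n) = M"
proof (induction n)
  case (Suc n)
  have "distr M M (T ^^ Suc n) = distr (distr M M (T ^^ n)) M T"
    by (simp add: distr_distr)
  then show ?case unfolding Suc distr_T .
qed (simp add: distr_id[unfolded id_def])

lemma vimage_funpow_sets [measurable]: "A \<in> sets M \<Longrightarrow> (T ^^ n) -` A \<in> sets M"
  using measurable_sets[OF funpow_measurable, of A n] by simp

lemma prob_vimage_funpow: "A \<in> sets M \<Longrightarrow> prob ((T ^^ n) -` A) = prob A"
  using measure_distr[OF funpow_measurable, of A n] by (simp add: distr_funpow)

lemma integral_funpow:
  fixes g :: "'a \<Rightarrow> 'b::{banach, second_countable_topology}"
  assumes "g \<in> borel_measurable M"
  shows "(\<integral>x. g ((T ^^ n) x) \<partial>M) = (\<integral>x. g x \<partial>M)"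
  using integral_distr[OF funpow_measurable assms, of n] by (simp add: distr_funpow)

lemma integrable_funpow:
  fixes g :: "'a \<Rightarrow> 'b::{banach, second_countable_topology}"
  assumes "integrable M g"
  shows "integrable M (\<lambda>x. g ((T ^^ n) x))"
  using integrable_distr[OF funpow_measurable[of n], of g] assms by (simp add: distr_funpow)

lemma lens_emeasure_rectangle:
  assumes "\<rho> \<in> C2 M" "A \<in> sets M" "B \<in> sets M"
  shows "emeasure (lens M T \<rho>) (A \<times> B) = emeasure \<rho> (T -` A \<times> T -` B)"
proof -
  have "map_prod T T \<in> M \<Otimes>\<^sub>M M \<rightarrow>\<^sub>M M \<Otimes>\<^sub>M M"
    unfolding map_prod_def case_prod_unfold by measurable
  then have "map_prod T T \<in> \<rho> \<rightarrow>\<^sub>M M \<Otimes>\<^sub>M M"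
    using measurable_cong_sets[OF C2_sets[OF assms(1)] refl] by blast
  then have "emeasure (lens M T \<rho>) (A \<times> B) = emeasure \<rho> (map_prod T T -` (A \<times> B) \<inter> space \<rho>)"
    unfolding lens_def using assms by (intro emeasure_distr) auto
  also have "map_prod T T -` (A \<times> B) \<inter> space \<rho> = T -` A \<times> T -` B"
    using assms by (auto simp: C2_space)
  finally show ?thesis .
qed

lemma lens_C2:
  assumes "\<rho> \<in> C2 M"
  shows "lens M T \<rho> \<in> C2 M"
proof (rule C2I)
  fix A assume A: "A \<in> sets M"
  have TA: "T -` A \<in> sets M" using vimage_funpow_sets[OF A, of 1] by simp
  have e: "emeasure M (T -` A) = emeasure M A"
    using prob_vimage_funpow[OF A, of 1] by (simp add: emeasure_eq_measure)
  show "emeasure (lens M T \<rho>) (A \<times> UNIV) = emeasure M A"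
    using lens_emeasure_rectangle[OF assms A UNIV_in_sets] C2_emeasure_marginals[OF assms TA] e by simp
  show "emeasure (lens M T \<rho>) (UNIV \<times> A) = emeasure M A"
    using lens_emeasure_rectangle[OF assms UNIV_in_sets A] C2_emeasure_marginals[OF assms TA] e by simp
qed (simp add: lens_def)

lemma lens_funpow_C2: "\<rho> \<in> C2 M \<Longrightarrow> (lens M T ^^ n) \<rho> \<in> C2 M"
  by (induction n) (auto intro: lens_C2)

lemma lens_funpow_rectangle:
  assumes "\<rho> \<in> C2 M" "A \<in> sets M" "B \<in> sets M"
  shows "measure ((lens M T ^^ n) \<rho>) (A \<times> B) = measure \<rho> ((T ^^ n) -` A \<times> (T ^^ n) -` B)"
  using assms(2,3)
\<comment> \<open>The outermost lens replaces the sides of the rectangle by their preimages under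
  \<open>T\<close>, so the induction hypothesis is needed for other sets than \<open>A\<close> and
  \<open>B\<close>.\<close>
proof (induction n arbitrary: A B)
  case (Suc n)
  have *: "T -` A \<in> sets M" "T -` B \<in> sets M"
    using vimage_funpow_sets[of _ 1] Suc.prems by auto
  have "measure ((lens M T ^^ Suc n) \<rho>) (A \<times> B) = measure ((lens M T ^^ n) \<rho>) (T -` A \<times> T -` B)"
    using lens_emeasure_rectangle[OF lens_funpow_C2[OF assms(1)] Suc.prems] by (simp add: measure_def)
  also have "\<dots> = measure \<rho> ((T ^^ n) -` T -` A \<times> (T ^^ n) -` T -` B)"
    by (rule Suc.IH[OF *])
  finally show ?case by (simp add: vimage_def)
qed simp

section \<open>Rigidity in terms of sets\<close>

text \<open>This is the symmetric difference of \<open>A\<close> and its preimage under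
  \<open>T ^^ n\<close>. The pointwise form makes invariance under complements and the inclusion for
  unions immediate.\<close>

definition moved :: "nat \<Rightarrow> 'a set \<Rightarrow> 'a set" where
  "moved n A = {x. ((T ^^ n) x \<in> A) \<noteq> (x \<in> A)}"

lemma moved_eq: "moved n A = ((T ^^ n) -` A - A) \<union> (A - (T ^^ n) -` A)"
  by (auto simp: moved_def)

lemma moved_sets [measurable]: "A \<in> sets M \<Longrightarrow> moved n A \<in> sets M"
  unfolding moved_eq by (intro sets.Un sets.Diff vimage_funpow_sets)

text \<open>The times are a parameter, so that one sequence can serve both \<open>T\<close> and the
  lens and can be passed to subsequences.\<close>

definition rigid_on_sets :: "(nat \<Rightarrow> nat) \<Rightarrow> bool" where
  "rigid_on_sets n \<longleftrightarrow> (\<forall>A\<in>sets M. (\<lambda>i. prob (moved (n i) A)) \<longlonglongrightarrow> 0)"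

text \<open>The sets that return along \<open>n\<close> are closed under complements and countable
  unions. For a union, finitely many pieces return and the rest has small measure, before and after
  applying the measure-preserving iterate.\<close>

lemma rigid_on_sets_of_generator:
  assumes \<G>: "sets M = sigma_sets UNIV (range \<G>)"
    and conv: "\<And>k. (\<lambda>i. prob (moved (n i) (\<G> k))) \<longlonglongrightarrow> 0"
  shows "rigid_on_sets n"
proof -
  \<comment> \<open>Measurability is carried through the induction because the estimates for unions
    need it.\<close>
  have "A \<in> sets M \<and> (\<lambda>i. prob (moved (n i) A)) \<longlonglongrightarrow> 0" if "A \<in> sigma_sets UNIV (range \<G>)" for A
    using that
  proof induction
    case (Basic a)
    then show ?case using conv by (auto simp: \<G>)
  next
    case Empty
    show ?case by (simp add: moved_def)
  next
    case (Compl a)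
    have "moved m (UNIV - a) = moved m a" for m by (auto simp: moved_def)
    then show ?case using Compl sets.compl_sets[of a M] by simp
  next
    case (Union a)
    let ?A = "\<Union>k. a k"
    have as: "a k \<in> sets M" for k using Union by blast
    then have As: "?A \<in> sets M" by auto
    define R where "R N = ?A - (\<Union>k<N. a k)" for N :: nat
    have Rs: "R N \<in> sets M" for N unfolding R_def using as by auto
    have "(\<lambda>N. prob (R N)) \<longlonglongrightarrow> prob (\<Inter>N. R N)"
    proof (rule finite_Lim_measure_decseq)
      show "range R \<subseteq> sets M" using Rs by auto
      show "decseq R" by (rule decseq_SucI) (auto simp: R_def)
    qed
    moreover have "(\<Inter>N. R N) = {}" by (auto simp: R_def)
    ultimately have R0: "(\<lambda>N. prob (R N)) \<longlonglongrightarrow> 0" by simp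
    \<comment> \<open>The remainder counts twice, once for the point and once for its image.\<close>
    have bound: "prob (moved m ?A) \<le> (\<Sum>k<N. prob (moved m (a k))) + 2 * prob (R N)" for m N
    proof -
      have "prob (moved m ?A) \<le> prob ((\<Union>k<N. moved m (a k)) \<union> (T ^^ m) -` R N \<union> R N)"
      proof (rule finite_measure_mono)
        show "moved m ?A \<subseteq> (\<Union>k<N. moved m (a k)) \<union> (T ^^ m) -` R N \<union> R N"
          by (auto simp: moved_def R_def)
        show "(\<Union>k<N. moved m (a k)) \<union> (T ^^ m) -` R N \<union> R N \<in> sets M"
          using as Rs by (intro sets.Un sets.finite_UN vimage_funpow_sets moved_sets) auto
      qed
      also have "\<dots> \<le> prob (\<Union>k<N. moved m (a k)) + prob ((T ^^ m) -` R N) + prob (R N)"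
        using as Rs by (intro order_trans[OF measure_Un_le] add_mono measure_Un_le
          sets.Un sets.finite_UN vimage_funpow_sets moved_sets) auto
      also have "prob (\<Union>k<N. moved m (a k)) \<le> (\<Sum>k<N. prob (moved m (a k)))"
        using as by (intro measure_UNION_le) (auto intro: moved_sets)
      finally show ?thesis by (simp add: prob_vimage_funpow[OF Rs])
    qed
    have "(\<lambda>i. prob (moved (n i) ?A)) \<longlonglongrightarrow> 0"
    proof (rule LIMSEQ_I)
      fix e :: real assume e: "e > 0"
      then obtain N where N: "prob (R N) < e / 4"
        using LIMSEQ_D[OF R0, of "e/4"] by (auto simp: abs_of_nonneg)
      have "(\<lambda>i. \<Sum>k<N. prob (moved (n i) (a k))) \<longlonglongrightarrow> (\<Sum>k<N. 0)"
        using Union by (intro tendsto_sum) auto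
      then have "(\<lambda>i. \<Sum>k<N. prob (moved (n i) (a k))) \<longlonglongrightarrow> 0" by simp
      then obtain I where I: "\<And>i. i \<ge> I \<Longrightarrow> \<bar>\<Sum>k<N. prob (moved (n i) (a k))\<bar> < e / 2"
        using LIMSEQ_D[of _ 0 "e/2"] e by (metis half_gt_zero diff_zero real_norm_def)
      show "\<exists>I. \<forall>i\<ge>I. norm (prob (moved (n i) ?A) - 0) < e"
      proof (intro exI allI impI)
        fix i assume "i \<ge> I"
        then show "norm (prob (moved (n i) ?A) - 0) < e"
          using bound[of "n i" N] I[of i] N by simp
      qed
    qed
    then show ?case using As by simp
  qed
  then show ?thesis by (auto simp: rigid_on_sets_def \<G>)
qed

text \<open>For an indicator function the squared distance in the definition of rigidity is exactly
  the measure of the moved set.\<close>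

lemma rigid_mp_imp_rigid_on_sets:
  assumes "rigid_mp M T"
  shows "\<exists>n. strict_mono n \<and> rigid_on_sets n"
proof -
  obtain n where n: "strict_mono n" and lim: "\<And>f :: 'a \<Rightarrow> complex. f \<in> borel_measurable M \<Longrightarrow>
      integrable M (\<lambda>x. (cmod (f x))\<^sup>2) \<Longrightarrow> (\<lambda>i. \<integral>x. (cmod (f ((T ^^ n i) x) - f x))\<^sup>2 \<partial>M) \<longlonglongrightarrow> 0"
    using assms unfolding rigid_mp_def by blast
  have "(\<lambda>i. prob (moved (n i) A)) \<longlonglongrightarrow> 0" if A: "A \<in> sets M" for A
  proof -
    have "(\<integral>x. (cmod (indicator A ((T ^^ m) x) - indicator A x))\<^sup>2 \<partial>M) = prob (moved m A)" for m
    proof -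
      have "(\<lambda>x. (cmod (indicator A ((T ^^ m) x) - indicator A x))\<^sup>2) = indicator (moved m A)"
        by (auto simp: moved_def indicator_def)
      then show ?thesis using A by (simp add: moved_sets)
    qed
    moreover have "integrable M (\<lambda>x. (cmod (indicator A x))\<^sup>2)"
    proof -
      have "(\<lambda>x. (cmod (indicator A x))\<^sup>2) = indicator A" by (auto simp: indicator_def)
      then show ?thesis using A by (simp add: integrable_indicator_iff emeasure_eq_measure)
    qed
    ultimately show ?thesis using lim[of "indicator A"] A by simp
  qed
  then show ?thesis using n by (auto simp: rigid_on_sets_def)
qed

text \<open>A simple function is bounded and changes along the orbit only where some level set is
  moved. There are finitely many level sets.\<close>

lemma rigid_on_sets_simple_function:
  fixes s :: "'a \<Rightarrow> complex"
  assumes n: "rigid_on_sets n" and s: "simple_function M s"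
  shows "(\<lambda>i. \<integral>x. (cmod (s ((T ^^ n i) x) - s x))\<^sup>2 \<partial>M) \<longlonglongrightarrow> 0"
proof -
  have fin: "finite (range s)" using s by (simp add: simple_function_def)
  have sy: "s -` {y} \<in> sets M" for y using simple_functionD(2)[OF s, of "{y}"] by simp
  obtain C where C: "\<And>x. cmod (s x) \<le> C"
    using finite_imp_bounded[OF fin] unfolding bounded_iff by blast
  have bound: "(\<integral>x. (cmod (s ((T ^^ m) x) - s x))\<^sup>2 \<partial>M) \<le> (2 * C)\<^sup>2 * (\<Sum>y\<in>range s. prob (moved m (s -` {y})))" for m
  proof -
    have int: "integrable M (\<lambda>x. (2 * C)\<^sup>2 * (\<Sum>y\<in>range s. indicat_real (moved m (s -` {y})) x))"
      using sy by (intro integrable_mult_right Bochner_Integration.integrable_sum)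
        (simp add: integrable_indicator_iff moved_sets emeasure_eq_measure)
    have "(cmod (s ((T ^^ m) x) - s x))\<^sup>2 \<le> (2 * C)\<^sup>2 * (\<Sum>y\<in>range s. indicat_real (moved m (s -` {y})) x)" for x
    proof (cases "s ((T ^^ m) x) = s x")
      case False
      have "cmod (s ((T ^^ m) x) - s x) \<le> 2 * C"
        using norm_triangle_ineq4[of "s ((T ^^ m) x)" "s x"] C[of x] C[of "(T ^^ m) x"] by simp
      then have "(cmod (s ((T ^^ m) x) - s x))\<^sup>2 \<le> (2 * C)\<^sup>2 * 1" unfolding mult_1_right by (rule power_mono) simp
      \<comment> \<open>The level set of the value \<open>s x\<close> contains \<open>x\<close> but
        not its image, so its summand equals 1.\<close>
      also have "1 \<le> (\<Sum>y\<in>range s. indicat_real (moved m (s -` {y})) x)"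
        using member_le_sum[of "s x" "range s" "\<lambda>y. indicat_real (moved m (s -` {y})) x"] fin False
        by (simp add: moved_def)
      finally show ?thesis by (simp add: mult_left_mono)
    qed (simp add: sum_nonneg)
    then have "(\<integral>x. (cmod (s ((T ^^ m) x) - s x))\<^sup>2 \<partial>M) \<le>
        (\<integral>x. (2 * C)\<^sup>2 * (\<Sum>y\<in>range s. indicat_real (moved m (s -` {y})) x) \<partial>M)"
      using int by (intro integral_mono') (auto intro!: sum_nonneg mult_nonneg_nonneg)
    also have "\<dots> = (2 * C)\<^sup>2 * (\<Sum>y\<in>range s. prob (moved m (s -` {y})))"
      using sy by (subst integral_mult_right_zero, subst Bochner_Integration.integral_sum)
        (auto simp: integrable_indicator_iff moved_sets emeasure_eq_measure)
    finally show ?thesis .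
  qed
  have "(\<lambda>i. (2 * C)\<^sup>2 * (\<Sum>y\<in>range s. prob (moved (n i) (s -` {y})))) \<longlonglongrightarrow> (2 * C)\<^sup>2 * (\<Sum>y\<in>range s. 0)"
    using n sy unfolding rigid_on_sets_def by (intro tendsto_intros) auto
  then have "(\<lambda>i. (2 * C)\<^sup>2 * (\<Sum>y\<in>range s. prob (moved (n i) (s -` {y})))) \<longlonglongrightarrow> 0" by simp
  then show ?thesis
  proof (rule Lim_null_comparison[rotated], intro always_eventually allI)
    fix i
    show "norm (\<integral>x. (cmod (s ((T ^^ n i) x) - s x))\<^sup>2 \<partial>M) \<le> (2 * C)\<^sup>2 * (\<Sum>y\<in>range s. prob (moved (n i) (s -` {y})))"
      using bound[of "n i"] by simp
  qed
qed

text \<open>Simple functions are dense in the square-integrable functions, and composition with an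
  iterate is an isometry, so the approximation error is the same for \<open>f\<close> and for its
  translate.\<close>

lemma rigid_on_sets_imp_rigid_mp:
  assumes mono: "strict_mono n" and n: "rigid_on_sets n"
  shows "rigid_mp M T"
  unfolding rigid_mp_def
proof (intro exI[of _ n] conjI mono allI impI)
  fix f :: "'a \<Rightarrow> complex"
  assume "f \<in> borel_measurable M \<and> integrable M (\<lambda>x. (cmod (f x))\<^sup>2)"
  then have f [measurable]: "f \<in> borel_measurable M" and int: "integrable M (\<lambda>x. (cmod (f x))\<^sup>2)" by auto
  \<comment> \<open>The bound by \<open>2 * cmod (f x)\<close> makes the error at most three times
    \<open>cmod (f x)\<close>, whence the dominating function with factor 9.\<close>
  obtain S where S: "\<And>i. simple_function M (S i)" "\<And>x. (\<lambda>i. S i x) \<longlonglongrightarrow> f x"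
      "\<And>i x. cmod (S i x) \<le> 2 * cmod (f x)"
    using borel_measurable_implies_sequence_metric[OF f, of 0] by auto
  have Sm [measurable]: "S i \<in> borel_measurable M" for i by (rule borel_measurable_simple_function[OF S(1)])
  have dom: "(cmod (f x - S i x))\<^sup>2 \<le> 9 * (cmod (f x))\<^sup>2" for x i
  proof -
    have "cmod (f x - S i x) \<le> 3 * cmod (f x)"
      using norm_triangle_ineq4[of "f x" "S i x"] S(3)[of i x] by simp
    then have "(cmod (f x - S i x))\<^sup>2 \<le> (3 * cmod (f x))\<^sup>2" by (rule power_mono) simp
    then show ?thesis by (simp add: power_mult_distrib)
  qed
  have "(\<lambda>i. \<integral>x. (cmod (f x - S i x))\<^sup>2 \<partial>M) \<longlonglongrightarrow> (\<integral>x. 0 \<partial>M)"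
  proof (rule integral_dominated_convergence)
    show "integrable M (\<lambda>x. 9 * (cmod (f x))\<^sup>2)" using int by simp
    show "AE x in M. (\<lambda>i. (cmod (f x - S i x))\<^sup>2) \<longlonglongrightarrow> 0"
    proof (rule AE_I2)
      fix x
      have "(\<lambda>i. (cmod (f x - S i x))\<^sup>2) \<longlonglongrightarrow> (cmod (f x - f x))\<^sup>2"
        by (intro tendsto_intros S)
      then show "(\<lambda>i. (cmod (f x - S i x))\<^sup>2) \<longlonglongrightarrow> 0" by simp
    qed
  qed (use dom in auto)
  then have approx: "(\<lambda>i. \<integral>x. (cmod (f x - S i x))\<^sup>2 \<partial>M) \<longlonglongrightarrow> 0" by simp
  show "(\<lambda>i. \<integral>x. (cmod (f ((T ^^ n i) x) - f x))\<^sup>2 \<partial>M) \<longlonglongrightarrow> 0"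
  proof (rule LIMSEQ_I)
    fix e :: real assume e: "e > 0"
    \<comment> \<open>With the factor 3 the two approximation errors contribute at most
      \<open>e / 2\<close> together. The simple function below contributes less than
      \<open>3 * (e / 6)\<close>.\<close>
    obtain j where j: "(\<integral>x. (cmod (f x - S j x))\<^sup>2 \<partial>M) < e / 12"
      using LIMSEQ_D[OF approx, of "e/12"] e by (auto simp: abs_of_nonneg)
    define s where "s = S j"
    have [measurable]: "s \<in> borel_measurable M" unfolding s_def by simp
    have int1: "integrable M (\<lambda>x. (cmod (f x - s x))\<^sup>2)"
    proof (rule Bochner_Integration.integrable_bound)
      show "integrable M (\<lambda>x. 9 * (cmod (f x))\<^sup>2)" using int by simp
      show "AE x in M. norm ((cmod (f x - s x))\<^sup>2) \<le> norm (9 * (cmod (f x))\<^sup>2)"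
        by (rule AE_I2) (simp add: s_def dom)
    qed measurable
    have int2: "integrable M (\<lambda>x. (cmod (f ((T ^^ m) x) - s ((T ^^ m) x)))\<^sup>2)" for m
      using integrable_funpow[OF int1] .
    obtain C where C: "\<And>x. cmod (s x) \<le> C"
      using finite_imp_bounded[of "range s"] S(1)[of j] unfolding bounded_iff
      by (auto simp: simple_function_def s_def)
    have int3: "integrable M (\<lambda>x. (cmod (s ((T ^^ m) x) - s x))\<^sup>2)" for m
    proof (rule integrable_const_bound[where B="(2 * C)\<^sup>2"])
      show "AE x in M. norm ((cmod (s ((T ^^ m) x) - s x))\<^sup>2) \<le> (2 * C)\<^sup>2"
      proof (rule AE_I2)
        fix x
        have "cmod (s ((T ^^ m) x) - s x) \<le> 2 * C"
          using norm_triangle_ineq4[of "s ((T ^^ m) x)" "s x"] C[of x] C[of "(T ^^ m) x"] by simp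
        from power_mono[OF this norm_ge_zero, of 2]
        show "norm ((cmod (s ((T ^^ m) x) - s x))\<^sup>2) \<le> (2 * C)\<^sup>2" by simp
      qed
    qed measurable
    have bound: "(\<integral>x. (cmod (f ((T ^^ m) x) - f x))\<^sup>2 \<partial>M) \<le> e / 2 + 3 * (\<integral>x. (cmod (s ((T ^^ m) x) - s x))\<^sup>2 \<partial>M)" for m
    proof -
      have "(\<integral>x. (cmod (f ((T ^^ m) x) - f x))\<^sup>2 \<partial>M) \<le>
        (\<integral>x. 3 * ((cmod (f ((T ^^ m) x) - s ((T ^^ m) x)))\<^sup>2 + (cmod (s ((T ^^ m) x) - s x))\<^sup>2 + (cmod (f x - s x))\<^sup>2) \<partial>M)"
      proof (rule integral_mono')
        show "integrable M (\<lambda>x. 3 * ((cmod (f ((T ^^ m) x) - s ((T ^^ m) x)))\<^sup>2 +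
            (cmod (s ((T ^^ m) x) - s x))\<^sup>2 + (cmod (f x - s x))\<^sup>2))"
          by (intro integrable_mult_right Bochner_Integration.integrable_add int1 int2 int3)
        fix x
        show "(cmod (f ((T ^^ m) x) - f x))\<^sup>2 \<le> 3 * ((cmod (f ((T ^^ m) x) - s ((T ^^ m) x)))\<^sup>2 +
            (cmod (s ((T ^^ m) x) - s x))\<^sup>2 + (cmod (f x - s x))\<^sup>2)"
          using norm_diff_sq_le_3[of "f ((T ^^ m) x)" "f x" "s ((T ^^ m) x)" "s x"]
          by (simp only: norm_minus_commute[of "s x" "f x"])
      qed simp
      also have "\<dots> = 3 * ((\<integral>x. (cmod (f ((T ^^ m) x) - s ((T ^^ m) x)))\<^sup>2 \<partial>M) +
          (\<integral>x. (cmod (s ((T ^^ m) x) - s x))\<^sup>2 \<partial>M) + (\<integral>x. (cmod (f x - s x))\<^sup>2 \<partial>M))"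
        using int1 int2 int3 by simp
      also have "(\<integral>x. (cmod (f ((T ^^ m) x) - s ((T ^^ m) x)))\<^sup>2 \<partial>M) = (\<integral>x. (cmod (f x - s x))\<^sup>2 \<partial>M)"
        by (rule integral_funpow) measurable
      finally show ?thesis using j by (simp add: s_def)
    qed
    obtain I where I: "\<And>i. i \<ge> I \<Longrightarrow> \<bar>\<integral>x. (cmod (s ((T ^^ n i) x) - s x))\<^sup>2 \<partial>M\<bar> < e / 6"
      using LIMSEQ_D[OF rigid_on_sets_simple_function[OF n S(1)[of j]], of "e/6"] e by (auto simp: s_def)
    show "\<exists>I. \<forall>i\<ge>I. norm ((\<integral>x. (cmod (f ((T ^^ n i) x) - f x))\<^sup>2 \<partial>M) - 0) < e"
    proof (intro exI allI impI)
      fix i assume "i \<ge> I"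
      have "0 \<le> (\<integral>x. (cmod (f ((T ^^ n i) x) - f x))\<^sup>2 \<partial>M)" by simp
      then show "norm ((\<integral>x. (cmod (f ((T ^^ n i) x) - f x))\<^sup>2 \<partial>M) - 0) < e"
        using bound[of "n i"] I[OF \<open>i \<ge> I\<close>] unfolding real_norm_def by linarith
    qed
  qed
qed

section \<open>From rigidity to uniform rigidity\<close>

text \<open>The perturbation bound is one-sided, so it is applied to the rectangle and its preimage
  in both orders.\<close>

lemma lens_displacement:
  assumes "\<rho> \<in> C2 M" "A \<in> sets M" "B \<in> sets M"
  shows "\<bar>measure ((lens M T ^^ m) \<rho>) (A \<times> B) - measure \<rho> (A \<times> B)\<bar> \<le> prob (moved m A) + prob (moved m B)"
proof -
  have s: "(T ^^ m) -` A \<in> sets M" "(T ^^ m) -` B \<in> sets M" using assms by auto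
  have "prob ((T ^^ m) -` A - A) \<le> prob (moved m A)" "prob (A - (T ^^ m) -` A) \<le> prob (moved m A)"
       "prob ((T ^^ m) -` B - B) \<le> prob (moved m B)" "prob (B - (T ^^ m) -` B) \<le> prob (moved m B)"
    using assms by (auto intro!: finite_measure_mono moved_sets simp: moved_eq)
  then show ?thesis
    using C2_rectangle_perturb[OF assms s] C2_rectangle_perturb[OF assms(1) s assms(2,3)]
    unfolding lens_funpow_rectangle[OF assms] by linarith
qed

text \<open>The starting points may vary with \<open>i\<close> because the displacement bound is
  uniform over couplings. Constant sequences give rigidity of the lens; varying ones are needed for
  uniformity.\<close>

lemma rigid_on_sets_lens_limit:
  assumes n: "rigid_on_sets n" and lim: "limitin (C2_topology M) \<sigma> \<rho> sequentially" and \<sigma>: "\<And>i. \<sigma> i \<in> C2 M"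
  shows "limitin (C2_topology M) (\<lambda>i. (lens M T ^^ n i) (\<sigma> i)) \<rho> sequentially"
  unfolding limitin_C2_topology
proof (intro conjI ballI)
  show "\<rho> \<in> C2 M" using lim by (simp add: limitin_C2_topology)
  show "\<forall>\<^sub>F i in sequentially. (lens M T ^^ n i) (\<sigma> i) \<in> C2 M" using \<sigma> by (simp add: lens_funpow_C2)
  fix A B assume AB: "A \<in> sets M" "B \<in> sets M"
  have "(\<lambda>i. prob (moved (n i) A) + prob (moved (n i) B)) \<longlonglongrightarrow> 0 + 0"
    using n AB unfolding rigid_on_sets_def by (intro tendsto_add) auto
  then have g: "(\<lambda>i. prob (moved (n i) A) + prob (moved (n i) B)) \<longlonglongrightarrow> 0" by simp
  have "(\<lambda>i. measure ((lens M T ^^ n i) (\<sigma> i)) (A \<times> B) - measure (\<sigma> i) (A \<times> B)) \<longlonglongrightarrow> 0"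
    by (rule Lim_null_comparison[OF _ g], rule always_eventually)
      (use lens_displacement[OF \<sigma> AB] in \<open>simp add: real_norm_def\<close>)
  moreover have "(\<lambda>i. measure (\<sigma> i) (A \<times> B)) \<longlonglongrightarrow> measure \<rho> (A \<times> B)"
    using lim AB by (simp add: limitin_C2_topology)
  ultimately show "(\<lambda>i. measure ((lens M T ^^ n i) (\<sigma> i)) (A \<times> B)) \<longlonglongrightarrow> measure \<rho> (A \<times> B)"
    using tendsto_add[of _ 0 sequentially "\<lambda>i. measure (\<sigma> i) (A \<times> B)"] by fastforce
qed

lemma rigid_on_sets_imp_top_rigid:
  assumes "strict_mono n" "rigid_on_sets n"
  shows "top_rigid (C2_topology M) (lens M T)"
  unfolding top_rigid_def
  using assms rigid_on_sets_lens_limit[OF assms(2), of "\<lambda>_. \<rho>" \<rho> for \<rho>] by auto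

text \<open>If uniformity failed, couplings displaced by at least \<open>e\<close> would have a
  convergent subsequence. Their images would converge to the same limit, contradicting the
  displacement.\<close>

lemma rigid_on_sets_imp_unif_rigid:
  assumes mono: "strict_mono n" and n: "rigid_on_sets n"
    and d: "Metric_space (C2 M) d" and top: "Metric_space.mtopology (C2 M) d = C2_topology M"
  shows "unif_rigid (C2 M) d (lens M T)"
  unfolding unif_rigid_def
proof (intro exI[of _ n] conjI mono allI impI)
  interpret d: Metric_space "C2 M" d by (rule d)
  fix e :: real assume e: "e > 0"
  show "\<forall>\<^sub>F i in sequentially. \<forall>\<rho>\<in>C2 M. d ((lens M T ^^ n i) \<rho>) \<rho> < e"
  proof (rule ccontr)
    let ?bad = "\<lambda>i \<rho>. \<rho> \<in> C2 M \<and> \<not> d ((lens M T ^^ n i) \<rho>) \<rho> < e"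
    assume "\<not> (\<forall>\<^sub>F i in sequentially. \<forall>\<rho>\<in>C2 M. d ((lens M T ^^ n i) \<rho>) \<rho> < e)"
    then have "\<exists>\<^sub>F i in sequentially. \<exists>\<rho>. ?bad i \<rho>" by (auto simp: frequently_def Ball_def)
    then have "infinite {i. \<exists>\<rho>. ?bad i \<rho>}"
      by (simp add: cofinite_eq_sequentially[symmetric] frequently_cofinite)
    then obtain r :: "nat \<Rightarrow> nat" where r: "strict_mono r" "\<And>j. r j \<in> {i. \<exists>\<rho>. ?bad i \<rho>}"
      using infinite_enumerate by blast
    then have "\<forall>j. \<exists>\<rho>. ?bad (r j) \<rho>" by simp
    then obtain \<sigma> where \<sigma>: "\<And>j. ?bad (r j) (\<sigma> j)" by metis
    have "compact_space d.mtopology" using compact_space_C2 by (simp add: top)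
    moreover have "range \<sigma> \<subseteq> C2 M" using \<sigma> by auto
    ultimately obtain \<rho> q where q: "\<rho> \<in> C2 M" "strict_mono q" "limitin d.mtopology (\<sigma> \<circ> q) \<rho> sequentially"
      unfolding d.compact_space_sequentially by blast
    \<comment> \<open>Rigidity passes to the subsequence of times along which the bad couplings
      converge.\<close>
    have "rigid_on_sets (n \<circ> (r \<circ> q))"
      unfolding rigid_on_sets_def
    proof
      fix A assume "A \<in> sets M"
      then have "(\<lambda>i. prob (moved (n i) A)) \<longlonglongrightarrow> 0" using n by (simp add: rigid_on_sets_def)
      from LIMSEQ_subseq_LIMSEQ[OF this strict_mono_o[OF r(1) q(2)]]
      show "(\<lambda>i. prob (moved ((n \<circ> (r \<circ> q)) i) A)) \<longlonglongrightarrow> 0" by (simp add: comp_def)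
    qed
    from rigid_on_sets_lens_limit[OF this, of "\<sigma> \<circ> q" \<rho>] q(3) \<sigma>
    have "limitin d.mtopology (\<lambda>j. (lens M T ^^ n (r (q j))) (\<sigma> (q j))) \<rho> sequentially"
      by (simp add: top comp_def)
    then have 1: "(\<lambda>j. d ((lens M T ^^ n (r (q j))) (\<sigma> (q j))) \<rho>) \<longlonglongrightarrow> 0"
      by (simp add: d.limitin_metric_dist_null)
    have 2: "(\<lambda>j. d (\<sigma> (q j)) \<rho>) \<longlonglongrightarrow> 0" using q(3) by (simp add: d.limitin_metric_dist_null)
    have 3: "e \<le> d ((lens M T ^^ n (r (q j))) (\<sigma> (q j))) \<rho> + d (\<sigma> (q j)) \<rho>" for j
      using \<sigma>[of "q j"] d.triangle'[of "(lens M T ^^ n (r (q j))) (\<sigma> (q j))" \<rho> "\<sigma> (q j)"] q(1)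
        lens_funpow_C2[of "\<sigma> (q j)" "n (r (q j))"] by (auto simp: d.commute)
    have "e \<le> 0 + 0" by (rule LIMSEQ_le_const[OF tendsto_add[OF 1 2]]) (use 3 in auto)
    then show False using e by simp
  qed
qed

end

section \<open>From recurrence of one coupling to rigidity\<close>

lemma ternary_weights_sums: "(\<lambda>i. 2 / 3 ^ Suc (i + j) :: real) sums (1 / 3 ^ j)"
proof -
  have "(\<lambda>i. 2 / 3 ^ Suc j * (1/3::real) ^ i) sums (2 / 3 ^ Suc j * (1 / (1 - 1/3)))"
    by (intro sums_mult geometric_sums) simp
  then show ?thesis by (simp add: power_add power_divide field_simps)
qed

lemma ternary_digits_summable:
  fixes a :: "nat \<Rightarrow> real"
  assumes "\<And>i. \<bar>a i\<bar> \<le> 1"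
  shows "summable (\<lambda>i. 2 / 3 ^ Suc i * a i)"
proof (rule summable_comparison_test')
  show "summable (\<lambda>i. 2 / 3 ^ Suc i :: real)"
    using ternary_weights_sums[of 0] by (simp add: sums_iff)
  show "norm (2 / 3 ^ Suc i * a i) \<le> 2 / 3 ^ Suc i" for i
    using assms[of i] by (simp add: abs_mult mult_left_le divide_right_mono)
qed

text \<open>Coefficients are allowed in the interval from -1 to 1, so that differences of two 0-1
  sequences are covered.\<close>

lemma ternary_tail_le:
  fixes a :: "nat \<Rightarrow> real"
  assumes "\<And>i. \<bar>a i\<bar> \<le> 1"
  shows "\<bar>(\<Sum>i. 2 / 3 ^ Suc i * a i) - (\<Sum>i<j. 2 / 3 ^ Suc i * a i)\<bar> \<le> 1 / 3 ^ j"
proof -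
  have s: "summable (\<lambda>i. 2 / 3 ^ Suc i * a i)" by (rule ternary_digits_summable[OF assms])
  have "(\<Sum>i. 2 / 3 ^ Suc i * a i) - (\<Sum>i<j. 2 / 3 ^ Suc i * a i) = (\<Sum>i. 2 / 3 ^ Suc (i + j) * a (i + j))"
    using suminf_minus_initial_segment[OF s, of j] by simp
  also have "\<bar>\<dots>\<bar> \<le> (\<Sum>i. 2 / 3 ^ Suc (i + j))"
  proof -
    have sw: "summable (\<lambda>i. 2 / 3 ^ Suc (i + j) :: real)"
      using ternary_weights_sums[of j] by (simp only: sums_iff)
    have le: "norm (2 / 3 ^ Suc (i + j) * a (i + j)) \<le> 2 / 3 ^ Suc (i + j)" for i
      using assms[of "i + j"] by (simp add: abs_mult mult_left_le divide_right_mono)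
    have sn: "summable (\<lambda>i. norm (2 / 3 ^ Suc (i + j) * a (i + j)))"
      by (rule summable_comparison_test'[OF sw]) (use le in simp)
    have "norm (\<Sum>i. 2 / 3 ^ Suc (i + j) * a (i + j)) \<le> (\<Sum>i. norm (2 / 3 ^ Suc (i + j) * a (i + j)))"
      by (rule summable_norm[OF sn])
    also have "\<dots> \<le> (\<Sum>i. 2 / 3 ^ Suc (i + j))" by (rule suminf_le[OF le sn sw])
    finally have "norm (\<Sum>i. 2 / 3 ^ Suc (i + j) * a (i + j)) \<le> (\<Sum>i. 2 / 3 ^ Suc (i + j))" .
    then show ?thesis by simp
  qed
  also have "\<dots> = 1 / 3 ^ j" using ternary_weights_sums[of j] by (simp only: sums_iff)
  finally show ?thesis .
qed

text \<open>At the first disagreement \<open>j\<close> the expansions differ by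
  \<open>2 / 3 ^ Suc j\<close>, while all later digits together can cancel at most half of
  that.\<close>

lemma ternary_separation:
  fixes a b :: "nat \<Rightarrow> real"
  assumes a: "\<And>i. a i \<in> {0, 1}" and b: "\<And>i. b i \<in> {0, 1}" and neq: "a k \<noteq> b k"
  shows "1 \<le> 3 ^ Suc k * \<bar>(\<Sum>i. 2 / 3 ^ Suc i * a i) - (\<Sum>i. 2 / 3 ^ Suc i * b i)\<bar>"
proof -
  have le: "\<bar>a i\<bar> \<le> 1" "\<bar>b i\<bar> \<le> 1" "\<bar>a i - b i\<bar> \<le> 1" for i using a[of i] b[of i] by auto
  define j where "j = (LEAST i. a i \<noteq> b i)"
  have j: "a j \<noteq> b j" "j \<le> k" and eq: "\<And>i. i < j \<Longrightarrow> a i = b i"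
    unfolding j_def using LeastI[of "\<lambda>i. a i \<noteq> b i", OF neq] neq
    by (auto intro: Least_le dest: not_less_Least)
  let ?S = "\<Sum>i. 2 / 3 ^ Suc i * (a i - b i)"
  have "(\<Sum>i. 2 / 3 ^ Suc i * a i) - (\<Sum>i. 2 / 3 ^ Suc i * b i) = ?S"
    using suminf_diff[OF ternary_digits_summable[of a] ternary_digits_summable[of b]] le
    by (simp add: right_diff_distrib diff_divide_distrib)
  moreover have "\<bar>?S - (\<Sum>i<Suc j. 2 / 3 ^ Suc i * (a i - b i))\<bar> \<le> 1 / 3 ^ Suc j"
    by (rule ternary_tail_le) (rule le)
  moreover have "(\<Sum>i<Suc j. 2 / 3 ^ Suc i * (a i - b i)) = 2 / 3 ^ Suc j * (a j - b j)"
    using eq by simp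
  moreover have "\<bar>2 / 3 ^ Suc j * (a j - b j)\<bar> = 2 / 3 ^ Suc j"
    using a[of j] b[of j] j(1) by (auto simp: abs_mult)
  ultimately have "1 / 3 ^ Suc j \<le> \<bar>(\<Sum>i. 2 / 3 ^ Suc i * a i) - (\<Sum>i. 2 / 3 ^ Suc i * b i)\<bar>"
    by linarith
  then have "1 \<le> 3 ^ Suc j * \<bar>(\<Sum>i. 2 / 3 ^ Suc i * a i) - (\<Sum>i. 2 / 3 ^ Suc i * b i)\<bar>"
    by (simp add: field_simps)
  also have "\<dots> \<le> 3 ^ Suc k * \<bar>(\<Sum>i. 2 / 3 ^ Suc i * a i) - (\<Sum>i. 2 / 3 ^ Suc i * b i)\<bar>"
    using j(2) by (intro mult_right_mono power_increasing) auto
  finally show ?thesis .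
qed

text \<open>The coding into the middle-thirds Cantor set. Its gaps, which binary expansions lack,
  allow each digit to be recovered in a Lipschitz way.\<close>

definition ternary_code :: "(nat \<Rightarrow> 'b set) \<Rightarrow> 'b \<Rightarrow> real" where
  "ternary_code \<G> x = (\<Sum>k. 2 / 3 ^ Suc k * indicat_real (\<G> k) x)"

lemma ternary_code_approx:
  "\<bar>ternary_code \<G> x - (\<Sum>k<N. 2 / 3 ^ Suc k * indicat_real (\<G> k) x)\<bar> \<le> 1 / 3 ^ N"
  unfolding ternary_code_def by (rule ternary_tail_le) (simp add: indicator_def)

lemma ternary_code_unit_interval: "0 \<le> ternary_code \<G> x" "ternary_code \<G> x \<le> 1"
proof -
  show "0 \<le> ternary_code \<G> x" unfolding ternary_code_def
    by (intro suminf_nonneg ternary_digits_summable) (auto simp: indicator_def)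
  show "ternary_code \<G> x \<le> 1" using ternary_code_approx[of \<G> x 0] by simp
qed

lemma ternary_code_measurable:
  assumes [measurable]: "\<And>k. \<G> k \<in> sets M"
  shows "ternary_code \<G> \<in> borel_measurable M"
  unfolding ternary_code_def by measurable

lemma ternary_code_separation:
  assumes "(x \<in> \<G> k) \<noteq> (y \<in> \<G> k)"
  shows "1 \<le> 3 ^ Suc k * \<bar>ternary_code \<G> x - ternary_code \<G> y\<bar>"
  unfolding ternary_code_def
  by (rule ternary_separation) (use assms in \<open>auto simp: indicator_def\<close>)

section \<open>Rank-one perturbations of the product coupling\<close>

context polish_prob_space
begin

lemma integrable_abs_bounded:
  fixes h :: "'a \<Rightarrow> real"
  assumes "h \<in> borel_measurable M" "\<And>x. \<bar>h x\<bar> \<le> C"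
  shows "integrable M h"
  using assms by (intro integrable_const_bound[where B=C]) auto

lemma centered_unit_interval:
  fixes f :: "'a \<Rightarrow> real"
  assumes [measurable]: "f \<in> borel_measurable M" and f01: "\<And>x. 0 \<le> f x" "\<And>x. f x \<le> 1"
  defines "\<phi> \<equiv> \<lambda>x. f x - (\<integral>x. f x \<partial>M)"
  shows "\<phi> \<in> borel_measurable M" "\<And>x. \<bar>\<phi> x\<bar> \<le> 1" "(\<integral>x. \<phi> x \<partial>M) = 0"
proof -
  show "\<phi> \<in> borel_measurable M" unfolding \<phi>_def by measurable
  have int: "integrable M f"
    by (rule integrable_abs_bounded[of _ 1]) (use f01 in auto)
  have "0 \<le> (\<integral>x. f x \<partial>M)" using f01 by (intro Bochner_Integration.integral_nonneg)
  moreover have "(\<integral>x. f x \<partial>M) \<le> (\<integral>x. 1 \<partial>M)" using f01 int by (intro integral_mono) auto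
  ultimately show "\<bar>\<phi> x\<bar> \<le> 1" for x
    using f01(1)[of x] f01(2)[of x] by (simp add: \<phi>_def prob_space)
  show "(\<integral>x. \<phi> x \<partial>M) = 0"
    unfolding \<phi>_def using int by (simp add: prob_space)
qed


text \<open>The density \<open>1 + \<phi> x * \<phi> y\<close> is nonnegative because
  \<open>\<phi>\<close> is bounded by 1, and both marginals are \<open>M\<close> because
  \<open>\<phi>\<close> has mean zero.\<close>

lemma rank_one_coupling:
  fixes \<phi> :: "'a \<Rightarrow> real"
  assumes [measurable]: "\<phi> \<in> borel_measurable M" and bnd: "\<And>x. \<bar>\<phi> x\<bar> \<le> 1" and zero: "(\<integral>x. \<phi> x \<partial>M) = 0"
  obtains \<rho> where "\<rho> \<in> C2 M" "\<And>A B. A \<in> sets M \<Longrightarrow> B \<in> sets M \<Longrightarrow>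
    measure \<rho> (A \<times> B) = prob A * prob B + (\<integral>x. indicator A x * \<phi> x \<partial>M) * (\<integral>x. indicator B x * \<phi> x \<partial>M)"
proof -
  define \<rho> where "\<rho> = density (M \<Otimes>\<^sub>M M) (\<lambda>p. ennreal (1 + \<phi> (fst p) * \<phi> (snd p)))"
  have nn: "0 \<le> 1 + \<phi> x * \<phi> y" for x y
    using bnd[of x] bnd[of y] mult_mono[of "\<bar>\<phi> x\<bar>" 1 "\<bar>\<phi> y\<bar>" 1] by (simp flip: abs_mult)
  \<comment> \<open>Nonnegativity is proved alongside because \<open>ennreal\<close> truncates
    negative numbers, and the real value of the measure is recovered from it later.\<close>
  have em: "emeasure \<rho> (A \<times> B) = ennreal (prob A * prob B + (\<integral>x. indicator A x * \<phi> x \<partial>M) * (\<integral>x. indicator B x * \<phi> x \<partial>M))"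
      and nonneg: "0 \<le> prob A * prob B + (\<integral>x. indicator A x * \<phi> x \<partial>M) * (\<integral>x. indicator B x * \<phi> x \<partial>M)"
    if [measurable]: "A \<in> sets M" "B \<in> sets M" for A B
  proof -
    define b where "b = (\<integral>x. indicator B x * \<phi> x \<partial>M)"
    have i0: "integrable M (\<lambda>x. indicator C x * \<phi> x)" "integrable M (indicat_real C)" if [measurable]: "C \<in> sets M" for C
      using bnd by (auto intro!: integrable_const_bound[where B=1] simp: indicator_def)
    have inner: "(\<integral>\<^sup>+y. ennreal (1 + \<phi> x * \<phi> y) * indicator (A \<times> B) (x, y) \<partial>M) = ennreal (indicator A x * (prob B + \<phi> x * b))"
      and inner_nn: "0 \<le> indicator A x * (prob B + \<phi> x * b)" for x
    proof -
      \<comment> \<open>The integrand multiplied out, so that its integral over \<open>y\<close>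
        follows by linearity.\<close>
      let ?h = "\<lambda>y. indicator A x * indicator B y + indicator A x * \<phi> x * (indicator B y * \<phi> y)"
      have h: "?h y = indicator A x * indicator B y * (1 + \<phi> x * \<phi> y)" for y by (simp add: algebra_simps)
      have hnn: "0 \<le> ?h y" for y unfolding h by (intro mult_nonneg_nonneg nn) auto
      have "(\<integral>\<^sup>+y. ennreal (1 + \<phi> x * \<phi> y) * indicator (A \<times> B) (x, y) \<partial>M) = (\<integral>\<^sup>+y. ennreal (?h y) \<partial>M)"
        unfolding h by (intro nn_integral_cong) (auto simp: indicator_def)
      also have "\<dots> = ennreal (\<integral>y. ?h y \<partial>M)"
        using i0 hnn by (intro nn_integral_eq_integral) auto
      also have I: "(\<integral>y. ?h y \<partial>M) = indicator A x * (prob B + \<phi> x * b)"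
        using i0[of B] by (simp add: b_def distrib_left mult.assoc)
      finally show "(\<integral>\<^sup>+y. ennreal (1 + \<phi> x * \<phi> y) * indicator (A \<times> B) (x, y) \<partial>M) = ennreal (indicator A x * (prob B + \<phi> x * b))" .
      show "0 \<le> indicator A x * (prob B + \<phi> x * b)"
        unfolding I[symmetric] by (intro Bochner_Integration.integral_nonneg hnn)
    qed
    have out: "indicator A x * (prob B + \<phi> x * b) = prob B * indicator A x + b * (indicator A x * \<phi> x)" for x
      by (simp add: algebra_simps)
    have I: "(\<integral>x. indicator A x * (prob B + \<phi> x * b) \<partial>M) = prob A * prob B + (\<integral>x. indicator A x * \<phi> x \<partial>M) * b"
      unfolding out using i0[of A] by simp
    show "0 \<le> prob A * prob B + (\<integral>x. indicator A x * \<phi> x \<partial>M) * (\<integral>x. indicator B x * \<phi> x \<partial>M)"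
      unfolding b_def[symmetric] I[symmetric] by (intro Bochner_Integration.integral_nonneg inner_nn)
    have "emeasure \<rho> (A \<times> B) = (\<integral>\<^sup>+p. ennreal (1 + \<phi> (fst p) * \<phi> (snd p)) * indicator (A \<times> B) p \<partial>(M \<Otimes>\<^sub>M M))"
      unfolding \<rho>_def by (rule emeasure_density) measurable
    also have "\<dots> = (\<integral>\<^sup>+x. \<integral>\<^sup>+y. ennreal (1 + \<phi> x * \<phi> y) * indicator (A \<times> B) (x, y) \<partial>M \<partial>M)"
      by (subst nn_integral_fst[where f="\<lambda>p. ennreal (1 + \<phi> (fst p) * \<phi> (snd p)) * indicator (A \<times> B) p",
        simplified fst_conv snd_conv]) simp_all
    also have "\<dots> = ennreal (\<integral>x. indicator A x * (prob B + \<phi> x * b) \<partial>M)"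
      unfolding inner using inner_nn i0[of A]
      by (intro nn_integral_eq_integral) (auto simp: out)
    finally show "emeasure \<rho> (A \<times> B) = ennreal (prob A * prob B + (\<integral>x. indicator A x * \<phi> x \<partial>M) * (\<integral>x. indicator B x * \<phi> x \<partial>M))"
      unfolding I unfolding b_def .
  qed
  have "\<rho> \<in> C2 M"
    by (rule C2I) (simp_all add: \<rho>_def[symmetric] em zero emeasure_eq_measure, simp add: \<rho>_def)
  moreover have "measure \<rho> (A \<times> B) = prob A * prob B + (\<integral>x. indicator A x * \<phi> x \<partial>M) * (\<integral>x. indicator B x * \<phi> x \<partial>M)"
    if "A \<in> sets M" "B \<in> sets M" for A B
    using em[OF that] nonneg[OF that] by (simp add: measure_def)
  ultimately show thesis using that by blast
qed

end

section \<open>Return times extracted from a recurrent coupling\<close>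

context polish_automorphism
begin

lemma integrable_bounded_mult_funpow:
  fixes h \<phi> :: "'a \<Rightarrow> real"
  assumes [measurable]: "h \<in> borel_measurable M" "\<phi> \<in> borel_measurable M"
    and h: "\<And>x. \<bar>h x\<bar> \<le> C" and \<phi>: "\<And>x. \<bar>\<phi> x\<bar> \<le> 1"
  shows "integrable M (\<lambda>x. h ((T ^^ n) x) * \<phi> x)" "\<bar>\<integral>x. h ((T ^^ n) x) * \<phi> x \<partial>M\<bar> \<le> C"
proof -
  have le: "\<bar>h ((T ^^ n) x) * \<phi> x\<bar> \<le> C" for x
    using h[of "(T ^^ n) x"] \<phi>[of x] mult_mono[of "\<bar>h ((T ^^ n) x)\<bar>" C "\<bar>\<phi> x\<bar>" 1]
    by (simp add: abs_mult)
  show int: "integrable M (\<lambda>x. h ((T ^^ n) x) * \<phi> x)"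
    by (rule integrable_abs_bounded[OF _ le]) measurable
  have "norm (\<integral>x. h ((T ^^ n) x) * \<phi> x \<partial>M) \<le> (\<integral>x. norm (h ((T ^^ n) x) * \<phi> x) \<partial>M)"
    by (rule integral_norm_bound)
  also have "\<dots> \<le> (\<integral>x. C \<partial>M)"
    by (rule integral_mono) (use int le in auto)
  finally show "\<bar>\<integral>x. h ((T ^^ n) x) * \<phi> x \<partial>M\<bar> \<le> C" by (simp add: prob_space)
qed

text \<open>Recurrence of the rank-one coupling controls finitely many rectangles at a time. A
  weighted sum of their masses equals a constant plus the square of the correlation for the
  truncated code, and truncation changes correlations uniformly little in \<open>n\<close>.\<close>

lemma pointwise_recurrent_correlation:
  assumes rec: "pointwise_recurrent (C2_topology M) (lens M T)"
    and \<G>s [measurable]: "\<And>k. \<G> k \<in> sets M" and e: "e > 0"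
    and \<phi>_meas [measurable]: "\<phi> \<in> borel_measurable M" and \<phi>1: "\<And>x. \<bar>\<phi> x\<bar> \<le> 1" and \<phi>0: "(\<integral>x. \<phi> x \<partial>M) = 0"
  defines "s \<equiv> \<lambda>n. \<integral>x. ternary_code \<G> ((T ^^ n) x) * \<phi> x \<partial>M"
  shows "infinite {n. \<bar>(s n)\<^sup>2 - (s 0)\<^sup>2\<bar> < e}"
proof -
  define w where "w k = (2 / 3 ^ Suc k :: real)" for k
  define g where "g N x = (\<Sum>k<N. w k * indicat_real (\<G> k) x)" for N x
  define f where "f = ternary_code \<G>"
  have s_def': "s n = (\<integral>x. f ((T ^^ n) x) * \<phi> x \<partial>M)" for n by (simp add: s_def f_def)
  have f_meas [measurable]: "f \<in> borel_measurable M" unfolding f_def by (rule ternary_code_measurable[OF \<G>s])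
  have g_meas [measurable]: "g N \<in> borel_measurable M" for N unfolding g_def by measurable
  have fg: "\<bar>f x - g N x\<bar> \<le> 1 / 3 ^ N" for x N
    unfolding f_def g_def w_def by (rule ternary_code_approx)
  have f1: "\<bar>f x\<bar> \<le> 1" for x
    using ternary_code_unit_interval[of \<G> x] by (simp add: f_def)
  obtain \<rho> where \<rho>: "\<rho> \<in> C2 M" and \<rho>_rect: "\<And>A B. A \<in> sets M \<Longrightarrow> B \<in> sets M \<Longrightarrow>
    measure \<rho> (A \<times> B) = prob A * prob B + (\<integral>x. indicator A x * \<phi> x \<partial>M) * (\<integral>x. indicator B x * \<phi> x \<partial>M)"
    using rank_one_coupling[OF \<phi>_meas \<phi>1 \<phi>0] by blast
  define t where "t N n = (\<integral>x. g N ((T ^^ n) x) * \<phi> x \<partial>M)" for N n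
  have g2: "\<bar>g N x\<bar> \<le> 2" for N x
  proof -
    have "1 / 3 ^ N \<le> (1::real)" by simp
    then show ?thesis using fg[of x N] f1[of x] by linarith
  qed
  have st: "\<bar>s n - t N n\<bar> \<le> 1 / 3 ^ N" for n N
  proof -
    have "s n - t N n = (\<integral>x. (f ((T ^^ n) x) - g N ((T ^^ n) x)) * \<phi> x \<partial>M)"
      unfolding s_def' t_def left_diff_distrib
      by (intro Bochner_Integration.integral_diff[symmetric]
        integrable_bounded_mult_funpow(1)[OF f_meas \<phi>_meas f1 \<phi>1] integrable_bounded_mult_funpow(1)[OF g_meas \<phi>_meas g2 \<phi>1])
    also have "\<bar>\<dots>\<bar> \<le> 1 / 3 ^ N"
      by (rule integrable_bounded_mult_funpow(2)[OF _ \<phi>_meas fg \<phi>1]) measurable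
    finally show ?thesis .
  qed
  have s1: "\<bar>s n\<bar> \<le> 1" for n
    unfolding s_def' by (rule integrable_bounded_mult_funpow(2)[OF f_meas \<phi>_meas f1 \<phi>1])
  have t2: "\<bar>t N n\<bar> \<le> 2" for n N
    unfolding t_def by (rule integrable_bounded_mult_funpow(2)[OF g_meas \<phi>_meas g2 \<phi>1])
  \<comment> \<open>\<open>H N \<sigma>\<close> is the integral of \<open>g N x * g N y\<close>
    against \<open>\<sigma>\<close>, written through rectangles so that its continuity is evident.
    The number \<open>c0 N\<close> is its value at the product measure, which the lens
    preserves.\<close>
  define H where "H N \<sigma> = (\<Sum>k<N. \<Sum>l<N. w k * w l * measure \<sigma> (\<G> k \<times> \<G> l))" for N \<sigma>
  define c0 where "c0 N = (\<Sum>k<N. \<Sum>l<N. w k * w l * (prob (\<G> k) * prob (\<G> l)))" for N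
  have H_cont: "continuous_map (C2_topology M) euclideanreal (H N)" for N
    unfolding H_def by (intro continuous_map_sum continuous_map_real_mult_left continuous_map_C2_rectangle) auto
  have H_val: "H N ((lens M T ^^ n) \<rho>) = c0 N + (t N n)\<^sup>2" for N n
  proof -
    define a where "a k = (\<integral>x. indicator ((T ^^ n) -` \<G> k) x * \<phi> x \<partial>M)" for k
    have "t N n = (\<Sum>k<N. w k * a k)"
    proof -
      have "t N n = (\<integral>x. (\<Sum>k<N. w k * (indicat_real (\<G> k) ((T ^^ n) x) * \<phi> x)) \<partial>M)"
        unfolding t_def g_def by (simp only: sum_distrib_right mult.assoc)
      also have "\<dots> = (\<Sum>k<N. \<integral>x. w k * (indicat_real (\<G> k) ((T ^^ n) x) * \<phi> x) \<partial>M)"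
        by (intro Bochner_Integration.integral_sum integrable_mult_right
          integrable_bounded_mult_funpow(1)[where C=1] \<phi>1) (auto simp: indicator_def)
      also have "\<dots> = (\<Sum>k<N. w k * a k)"
        unfolding a_def by (simp add: indicator_vimage[symmetric] comp_def)
      finally show ?thesis .
    qed
    then have "(t N n)\<^sup>2 = (\<Sum>k<N. \<Sum>l<N. w k * w l * (a k * a l))"
      unfolding power2_eq_square by (simp add: sum_product ac_simps)
    moreover have "H N ((lens M T ^^ n) \<rho>) = (\<Sum>k<N. \<Sum>l<N. w k * w l * (prob (\<G> k) * prob (\<G> l)) + w k * w l * (a k * a l))"
      unfolding H_def a_def
      by (simp add: lens_funpow_rectangle[OF \<rho>] \<rho>_rect prob_vimage_funpow distrib_left)
    ultimately show ?thesis by (simp add: c0_def sum.distrib)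
  qed
  \<comment> \<open>Since \<open>s\<close> and \<open>t N\<close> are bounded by 1 and 2, truncation
    costs at most \<open>3 / 3 ^ N\<close>, below \<open>e / 4\<close>, for each square. The
    neighbourhood \<open>?U\<close> uses the remaining \<open>e / 2\<close>.\<close>
  obtain N where "inverse (3::real) ^ N < e / 12"
    using real_arch_pow_inv[of "e / 12" "inverse 3"] e by auto
  then have N: "1 / (3::real) ^ N < e / 12" by (simp add: power_divide inverse_eq_divide)
  let ?U = "{\<sigma> \<in> topspace (C2_topology M). H N \<sigma> \<in> ball (H N \<rho>) (e/2)}"
  have "openin (C2_topology M) ?U" by (intro openin_continuous_map_preimage[OF H_cont]) simp
  moreover have "\<rho> \<in> ?U" using \<rho> e by simp
  moreover have "\<rho> \<in> topspace (C2_topology M)" using \<rho> by simp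
  ultimately have "infinite {n. (lens M T ^^ n) \<rho> \<in> ?U}"
    using rec unfolding pointwise_recurrent_def by blast
  moreover have "{n. (lens M T ^^ n) \<rho> \<in> ?U} \<subseteq> {n. \<bar>(s n)\<^sup>2 - (s 0)\<^sup>2\<bar> < e}"
  proof clarify
    fix n assume "H N ((lens M T ^^ n) \<rho>) \<in> ball (H N \<rho>) (e / 2)"
    then have "\<bar>(t N n)\<^sup>2 - (t N 0)\<^sup>2\<bar> < e / 2"
      using H_val[of N n] H_val[of N 0] by (simp add: dist_real_def abs_minus_commute)
    moreover have "\<bar>(s i)\<^sup>2 - (t N i)\<^sup>2\<bar> \<le> e / 4" for i
    proof -
      have "\<bar>(s i)\<^sup>2 - (t N i)\<^sup>2\<bar> = \<bar>s i - t N i\<bar> * \<bar>s i + t N i\<bar>"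
        by (simp add: power2_eq_square abs_mult[symmetric] algebra_simps)
      also have "\<dots> \<le> (1 / 3 ^ N) * 3"
        using st[of i N] s1[of i] t2[of N i] by (intro mult_mono) auto
      finally show ?thesis using N by simp
    qed
    from this[of n] this[of 0] calculation show "\<bar>(s n)\<^sup>2 - (s 0)\<^sup>2\<bar> < e" by linarith
qed

  ultimately show ?thesis by (rule infinite_super[rotated])
qed

text \<open>With \<open>c\<close> the squared norm of \<open>\<phi>\<close>, the squared distances
  from its translate to \<open>\<phi>\<close> and to \<open>-\<phi>\<close> are
  \<open>2 * (c - s n)\<close> and \<open>2 * (c + s n)\<close>. If the square of \<open>s n\<close>
  is near that of \<open>c\<close>, one of them is small; in the second case doubling the time
  restores the sign.\<close>

lemma correlation_recurrence_imp_return: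
  fixes f :: "'a \<Rightarrow> real"
  assumes f_meas [measurable]: "f \<in> borel_measurable M" and f01: "\<And>x. 0 \<le> f x" "\<And>x. f x \<le> 1"
  defines "\<phi> \<equiv> \<lambda>x. f x - (\<integral>x. f x \<partial>M)"
  assumes rec_s: "\<And>e. e > 0 \<Longrightarrow>
      infinite {n. \<bar>(\<integral>x. f ((T ^^ n) x) * \<phi> x \<partial>M)\<^sup>2 - (\<integral>x. f ((T ^^ 0) x) * \<phi> x \<partial>M)\<^sup>2\<bar> < e}"
    and e: "e > 0"
  shows "\<exists>i>N. (\<integral>x. (f ((T ^^ i) x) - f x)\<^sup>2 \<partial>M) < e"
proof -
  have \<phi>_meas [measurable]: "\<phi> \<in> borel_measurable M" and \<phi>1: "\<And>x. \<bar>\<phi> x\<bar> \<le> 1" and \<phi>0: "(\<integral>x. \<phi> x \<partial>M) = 0"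
    unfolding \<phi>_def by (rule centered_unit_interval[OF f_meas f01])+
  have \<phi>_int: "integrable M \<phi>" by (rule integrable_abs_bounded[OF \<phi>_meas \<phi>1])
  have f1: "\<bar>f x\<bar> \<le> 1" for x using f01[of x] by simp
  define s where "s n = (\<integral>x. f ((T ^^ n) x) * \<phi> x \<partial>M)" for n
  define c where "c = s 0"
  \<comment> \<open>Replacing \<open>f\<close> by \<open>\<phi>\<close> in the first factor changes
    nothing because \<open>\<phi>\<close> has mean zero.\<close>
  have s_\<phi>: "s n = (\<integral>x. \<phi> ((T ^^ n) x) * \<phi> x \<partial>M)" for n
  proof -
    have "\<phi> ((T ^^ n) x) * \<phi> x = f ((T ^^ n) x) * \<phi> x - (\<integral>x. f x \<partial>M) * \<phi> x" for x
      by (simp add: \<phi>_def left_diff_distrib)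
    then have "(\<integral>x. \<phi> ((T ^^ n) x) * \<phi> x \<partial>M) = (\<integral>x. f ((T ^^ n) x) * \<phi> x - (\<integral>x. f x \<partial>M) * \<phi> x \<partial>M)"
      by simp
    also have "\<dots> = s n - (\<integral>x. f x \<partial>M) * (\<integral>x. \<phi> x \<partial>M)"
      unfolding s_def using \<phi>_int integrable_bounded_mult_funpow(1)[OF f_meas \<phi>_meas f1 \<phi>1, of n] by simp
    finally show ?thesis by (simp add: \<phi>0)
  qed
  have sq_int: "integrable M (\<lambda>x. (\<phi> ((T ^^ n) x))\<^sup>2)" for n
    using \<phi>1 by (intro integrable_abs_bounded[where C=1]) (auto simp: abs_square_le_1)
  have sq: "(\<integral>x. (\<phi> ((T ^^ n) x))\<^sup>2 \<partial>M) = c" for n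
    using integral_funpow[of "\<lambda>x. (\<phi> x)\<^sup>2" n] s_\<phi>[of 0] by (simp add: c_def power2_eq_square)
  have pi: "integrable M (\<lambda>x. \<phi> ((T ^^ n) x) * \<phi> x)" for n
    by (rule integrable_bounded_mult_funpow(1)[OF \<phi>_meas \<phi>_meas \<phi>1 \<phi>1])
  have minus: "(\<integral>x. (\<phi> ((T ^^ n) x) - \<phi> x)\<^sup>2 \<partial>M) = 2 * (c - s n)"
    and plus: "(\<integral>x. (\<phi> ((T ^^ n) x) + \<phi> x)\<^sup>2 \<partial>M) = 2 * (c + s n)" for n
  proof -
    \<comment> \<open>The term without iteration is written with \<open>T ^^ 0\<close>, so that
      \<open>sq_int\<close> and \<open>sq\<close> apply to it as well.\<close>
    have e1: "(\<phi> ((T ^^ n) x) - \<phi> x)\<^sup>2 = (\<phi> ((T ^^ n) x))\<^sup>2 + (\<phi> ((T ^^ 0) x))\<^sup>2 - 2 * (\<phi> ((T ^^ n) x) * \<phi> x)"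
     and e2: "(\<phi> ((T ^^ n) x) + \<phi> x)\<^sup>2 = (\<phi> ((T ^^ n) x))\<^sup>2 + (\<phi> ((T ^^ 0) x))\<^sup>2 + 2 * (\<phi> ((T ^^ n) x) * \<phi> x)" for x
      by (simp_all add: power2_eq_square algebra_simps)
    show "(\<integral>x. (\<phi> ((T ^^ n) x) - \<phi> x)\<^sup>2 \<partial>M) = 2 * (c - s n)"
      unfolding e1 using sq_int[of n] sq_int[of 0] pi[of n] sq[of n] sq[of 0] s_\<phi>[of n] by simp
    show "(\<integral>x. (\<phi> ((T ^^ n) x) + \<phi> x)\<^sup>2 \<partial>M) = 2 * (c + s n)"
      unfolding e2 using sq_int[of n] sq_int[of 0] pi[of n] sq[of n] sq[of 0] s_\<phi>[of n] by simp
  qed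
  have sc: "\<bar>s n\<bar> \<le> c" for n
  proof -
    have "0 \<le> 2 * (c - s n)" unfolding minus[symmetric] by simp
    moreover have "0 \<le> 2 * (c + s n)" unfolding plus[symmetric] by simp
    ultimately show ?thesis by (simp add: abs_le_iff)
  qed
  define E where "E n = (\<integral>x. (f ((T ^^ n) x) - f x)\<^sup>2 \<partial>M)" for n
  have E: "E n = 2 * (c - s n)" for n
    unfolding minus[symmetric] E_def \<phi>_def by simp
  have double: "E (n + n) \<le> 8 * (c + s n)" for n
  proof -
    have d_int: "integrable M (\<lambda>x. (\<phi> ((T ^^ n) x) + \<phi> x)\<^sup>2)"
    proof (rule integrable_abs_bounded[where C=4])
      fix x
      have "\<bar>\<phi> ((T ^^ n) x) + \<phi> x\<bar> \<le> 2" using \<phi>1[of x] \<phi>1[of "(T ^^ n) x"] by linarith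
      then have "\<bar>\<phi> ((T ^^ n) x) + \<phi> x\<bar>\<^sup>2 \<le> 2\<^sup>2" by (rule power_mono) simp
      then show "\<bar>(\<phi> ((T ^^ n) x) + \<phi> x)\<^sup>2\<bar> \<le> 4" by simp
    qed measurable
    note d_int' = integrable_funpow[OF d_int, of n]
    have ptw: "(f ((T ^^ (n + n)) x) - f x)\<^sup>2 \<le> 2 * (\<phi> ((T ^^ n) ((T ^^ n) x)) + \<phi> ((T ^^ n) x))\<^sup>2 + 2 * (\<phi> ((T ^^ n) x) + \<phi> x)\<^sup>2" for x
    proof -
      \<comment> \<open>The double-time difference telescopes through two sums, the first being the
        second evaluated at the image under \<open>T ^^ n\<close>.\<close>
      have "f ((T ^^ (n + n)) x) - f x = (\<phi> ((T ^^ n) ((T ^^ n) x)) + \<phi> ((T ^^ n) x)) - (\<phi> ((T ^^ n) x) + \<phi> x)"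
        by (simp add: \<phi>_def funpow_add)
      moreover have "(u - v)\<^sup>2 \<le> 2 * u\<^sup>2 + 2 * v\<^sup>2" for u v :: real
        using zero_le_power2[of "u + v"] by (simp add: power2_eq_square algebra_simps)
      ultimately show ?thesis by (simp only:)
    qed
    have "E (n + n) \<le> (\<integral>x. 2 * (\<phi> ((T ^^ n) ((T ^^ n) x)) + \<phi> ((T ^^ n) x))\<^sup>2 + 2 * (\<phi> ((T ^^ n) x) + \<phi> x)\<^sup>2 \<partial>M)"
      unfolding E_def using d_int d_int' ptw by (intro integral_mono') auto
    also have "\<dots> = 2 * (\<integral>x. (\<phi> ((T ^^ n) ((T ^^ n) x)) + \<phi> ((T ^^ n) x))\<^sup>2 \<partial>M) + 2 * (\<integral>x. (\<phi> ((T ^^ n) x) + \<phi> x)\<^sup>2 \<partial>M)"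
      using d_int d_int' by simp
    also have "(\<integral>x. (\<phi> ((T ^^ n) ((T ^^ n) x)) + \<phi> ((T ^^ n) x))\<^sup>2 \<partial>M) = (\<integral>x. (\<phi> ((T ^^ n) x) + \<phi> x)\<^sup>2 \<partial>M)"
      by (rule integral_funpow) measurable
    finally show ?thesis unfolding plus by simp
  qed
  have "\<exists>i>N. E i < e"
  proof (cases "c = 0")
    \<comment> \<open>Here every \<open>s n\<close> vanishes as well, so any time is a perfect
      return.\<close>
    case True
    then have "E (Suc N) = 0" using E[of "Suc N"] sc[of "Suc N"] by simp
    then show ?thesis using e by (intro exI[of _ "Suc N"]) simp
  next
    case False
    then have c: "c > 0" using sc[of 0] by simp
    \<comment> \<open>Factoring the difference of squares and dividing by \<open>c\<close> leaves
      \<open>c - \<bar>s n\<bar> < e / 8\<close>; the 8 matches the constant in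
      \<open>double\<close>.\<close>
    obtain n where n: "n > N" "\<bar>(s n)\<^sup>2 - c\<^sup>2\<bar> < e * c / 8"
      using rec_s[of "e * c / 8"] e c unfolding s_def[symmetric] c_def[symmetric] infinite_nat_iff_unbounded by auto
    have "c * (c - \<bar>s n\<bar>) \<le> (c + \<bar>s n\<bar>) * (c - \<bar>s n\<bar>)"
      using sc[of n] by (intro mult_right_mono) auto
    also have "\<dots> = c\<^sup>2 - (s n)\<^sup>2" by (simp add: power2_eq_square algebra_simps)
    also have "\<dots> \<le> \<bar>(s n)\<^sup>2 - c\<^sup>2\<bar>" by simp
    also have "\<dots> < c * (e / 8)" using n(2) by (simp add: mult.commute)
    finally have *: "c - \<bar>s n\<bar> < e / 8" using c by (simp only: mult_less_cancel_left_pos)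
    show ?thesis
    proof (cases "s n \<ge> 0")
      case True
      then show ?thesis using * E[of n] n e by (intro exI[of _ n]) simp
    next
      case False
      then show ?thesis using * double[of n] n e by (intro exI[of _ "n + n"]) simp
    qed
  qed
  then show ?thesis by (simp only: E_def)
qed

text \<open>Taking \<open>\<phi>\<close> to be the centered code of a generator makes the code
  return in mean square. A Chebyshev estimate passes this to each set of the generator.\<close>

lemma pointwise_recurrent_imp_rigid_mp:
  assumes rec: "pointwise_recurrent (C2_topology M) (lens M T)"
  shows "rigid_mp M T"
proof -
  obtain \<G> :: "nat \<Rightarrow> 'a set" where \<G>: "sets M = sigma_sets UNIV (range \<G>)"
    by (rule ex_countable_generator)
  have \<G>s [measurable]: "\<G> k \<in> sets M" for k unfolding \<G> by auto
  define f where "f = ternary_code \<G>"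
  have f_meas [measurable]: "f \<in> borel_measurable M" unfolding f_def by (rule ternary_code_measurable[OF \<G>s])
  have f01: "0 \<le> f x" "f x \<le> 1" for x
    unfolding f_def by (rule ternary_code_unit_interval)+
  define E where "E n = (\<integral>x. (f ((T ^^ n) x) - f x)\<^sup>2 \<partial>M)" for n
  define \<phi> where "\<phi> = (\<lambda>x. f x - (\<integral>x. f x \<partial>M))"
  have \<phi>: "\<phi> \<in> borel_measurable M" "\<bar>\<phi> x\<bar> \<le> 1" "(\<integral>x. \<phi> x \<partial>M) = 0" for x
    unfolding \<phi>_def by (rule centered_unit_interval[OF f_meas f01])+
  note corr = pointwise_recurrent_correlation[where \<G>=\<G>, OF rec \<G>s _ \<phi>, folded f_def]
  have small: "\<exists>i>N. E i < e" if "e > 0" for e N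
    unfolding E_def
    by (rule correlation_recurrence_imp_return[OF f_meas f01 _ that]) (use corr in \<open>simp add: \<phi>_def\<close>)
  \<comment> \<open>Small values of \<open>E\<close> occur beyond every time, so they can be chosen
    one after another along a strictly increasing sequence.\<close>
  have "\<exists>q. \<forall>i. E (q i) < 1 / Suc i \<and> q i < q (Suc i)"
  proof (rule dependent_nat_choice)
    show "\<exists>x. E x < 1 / real (Suc 0)" using small[of 1 0] by auto
    show "\<exists>y. E y < 1 / real (Suc (Suc i)) \<and> x < y" for x i
      using small[of "1 / real (Suc (Suc i))" x] by auto
  qed
  then obtain q where q: "\<And>i. E (q i) < 1 / Suc i" "strict_mono q" by (auto simp: strict_mono_Suc_iff)
  have E0: "(\<lambda>i. E (q i)) \<longlonglongrightarrow> 0"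
  proof (rule tendsto_sandwich[OF _ _ tendsto_const LIMSEQ_inverse_real_of_nat])
    show "\<forall>\<^sub>F i in sequentially. 0 \<le> E (q i)" by (simp add: E_def)
    show "\<forall>\<^sub>F i in sequentially. E (q i) \<le> inverse (real (Suc i))"
      using q(1) by (intro always_eventually) (auto simp: inverse_eq_divide intro: less_imp_le)
  qed
  have "rigid_on_sets q"
  proof (rule rigid_on_sets_of_generator[OF \<G>])
    fix k
    \<comment> \<open>Chebyshev: where membership in \<open>\<G> k\<close> changes, the code changes
      by at least \<open>1 / 3 ^ Suc k\<close>.\<close>
    have bound: "prob (moved i (\<G> k)) \<le> (3 ^ Suc k)\<^sup>2 * E i" for i
    proof -
      have fi: "integrable M (\<lambda>x. (f ((T ^^ i) x) - f x)\<^sup>2)"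
      proof (rule integrable_abs_bounded[where C=1])
        fix x
        have "\<bar>f ((T ^^ i) x) - f x\<bar> \<le> 1" using f01[of x] f01[of "(T ^^ i) x"] by linarith
        then show "\<bar>(f ((T ^^ i) x) - f x)\<^sup>2\<bar> \<le> 1" by (simp add: abs_square_le_1)
      qed measurable
      have "indicat_real (moved i (\<G> k)) x \<le> (3 ^ Suc k)\<^sup>2 * (f ((T ^^ i) x) - f x)\<^sup>2" for x
      proof (cases "x \<in> moved i (\<G> k)")
        case True
        have "1 \<le> 3 ^ Suc k * \<bar>f ((T ^^ i) x) - f x\<bar>"
          unfolding f_def by (rule ternary_code_separation) (use True in \<open>simp add: moved_def\<close>)
        then have "1\<^sup>2 \<le> (3 ^ Suc k * \<bar>f ((T ^^ i) x) - f x\<bar>)\<^sup>2" by (rule power_mono) simp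
        then show ?thesis using True by (simp add: power_mult_distrib)
      qed simp
      then have "(\<integral>x. indicat_real (moved i (\<G> k)) x \<partial>M) \<le> (\<integral>x. (3 ^ Suc k)\<^sup>2 * (f ((T ^^ i) x) - f x)\<^sup>2 \<partial>M)"
        using fi by (intro integral_mono') auto
      then show ?thesis by (simp add: E_def moved_sets)
    qed
    have "(\<lambda>i. (3 ^ Suc k)\<^sup>2 * E (q i)) \<longlonglongrightarrow> (3 ^ Suc k)\<^sup>2 * 0" by (intro tendsto_intros E0)
    then have "(\<lambda>i. (3 ^ Suc k)\<^sup>2 * E (q i)) \<longlonglongrightarrow> 0" by simp
    then show "(\<lambda>i. prob (moved (q i) (\<G> k))) \<longlonglongrightarrow> 0"
      by (rule Lim_null_comparison[rotated]) (use bound in \<open>auto intro!: always_eventually simp del: power_Suc\<close>)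
  qed
  then show ?thesis using q(2) rigid_on_sets_imp_rigid_mp by blast
qed

lemma unif_rigid_imp_top_rigid:
  assumes d: "Metric_space (C2 M) d" "Metric_space.mtopology (C2 M) d = C2_topology M"
    and u: "unif_rigid (C2 M) d (lens M T)"
  shows "top_rigid (C2_topology M) (lens M T)"
proof -
  interpret d: Metric_space "C2 M" d by (rule d)
  obtain n :: "nat \<Rightarrow> nat" where n: "strict_mono n"
    "\<And>e. e > 0 \<Longrightarrow> \<forall>\<^sub>F i in sequentially. \<forall>\<rho>\<in>C2 M. d ((lens M T ^^ n i) \<rho>) \<rho> < e"
    using u by (auto simp: unif_rigid_def)
  have "limitin d.mtopology (\<lambda>i. (lens M T ^^ n i) \<rho>) \<rho> sequentially" if "\<rho> \<in> C2 M" for \<rho>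
    unfolding d.limitin_metric
  proof (intro conjI that allI impI)
    fix e :: real assume "e > 0"
    from n(2)[OF this] show "\<forall>\<^sub>F i in sequentially. (lens M T ^^ n i) \<rho> \<in> C2 M \<and> d ((lens M T ^^ n i) \<rho>) \<rho> < e"
      by eventually_elim (use that lens_funpow_C2 in auto)
  qed
  then show ?thesis using n(1) d(2) by (auto simp: top_rigid_def)
qed

end

theorem mainTheorem4:
  fixes M :: "'a::polish_space measure" and T :: "'a \<Rightarrow> 'a"
  assumes "sets M = sets borel" and "prob_space M" and "aut M T"
  shows "(rigid_mp M T \<longleftrightarrow> pointwise_recurrent (C2_topology M) (lens M T))
       \<and> (rigid_mp M T \<longleftrightarrow> top_rigid (C2_topology M) (lens M T))
       \<and> (rigid_mp M T \<longleftrightarrow> (\<forall>d. Metric_space (C2 M) d \<and>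
              Metric_space.mtopology (C2 M) d = C2_topology M \<longrightarrow> unif_rigid (C2 M) d (lens M T)))"
proof -
  interpret prob_space M by (rule assms)
  interpret polish_automorphism M T by unfold_locales (use assms in auto)
  \<comment> \<open>The implications run from rigidity of \<open>T\<close> to rigidity of the lens,
    to recurrence and back to \<open>T\<close>. Uniform rigidity is inserted between rigidity of
    \<open>T\<close> and that of the lens.\<close>
  have "rigid_mp M T \<Longrightarrow> top_rigid (C2_topology M) (lens M T)"
    using rigid_mp_imp_rigid_on_sets rigid_on_sets_imp_top_rigid by blast
  moreover have "top_rigid (C2_topology M) (lens M T) \<Longrightarrow> pointwise_recurrent (C2_topology M) (lens M T)"
    by (rule top_rigid_imp_pointwise_recurrent)
  moreover have "rigid_mp M T \<Longrightarrow> (\<forall>d. Metric_space (C2 M) d \<and>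
              Metric_space.mtopology (C2 M) d = C2_topology M \<longrightarrow> unif_rigid (C2 M) d (lens M T))"
    using rigid_mp_imp_rigid_on_sets rigid_on_sets_imp_unif_rigid by blast
  moreover have "(\<forall>d. Metric_space (C2 M) d \<and>
              Metric_space.mtopology (C2 M) d = C2_topology M \<longrightarrow> unif_rigid (C2 M) d (lens M T)) \<Longrightarrow>
      top_rigid (C2_topology M) (lens M T)"
    using ex_metric_C2 unif_rigid_imp_top_rigid by blast
  ultimately show ?thesis using pointwise_recurrent_imp_rigid_mp by blast
qed

end
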